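(* Let $X$ be a topological space and let $1\to\mathcal N\to\mathbf G\xrightarrow{F}\mathbf H\to 1$ be a central extension of gerbes on $X$. Let $i,j\in\operatorname{Ob}\mathbf G(X)$ and let $h\in\mathbf H(X)(F(i),F(j))$. Then there exists an isomorphism $g\in\mathbf G(X)(i,j)$ satisfying $F(g)=h$ if and only if $\operatorname{cl}^1_F(h)=1$ in $\check{\mathrm H}^1(X,\mathcal N)$.
   Context: **Gerbes.** A prestack of groupoids $\mathbf G$ on a topological space $X$ is a pseudofunctor $U\mapsto\mathbf G(U)$ from the opposite of the poset of open sets of $X$ to categories, with values in groupoids. The restriction functors are written $i\mapsto i|_V$, and the coherence isomorphisms $(i|_V)|_W\cong i|_W$ are used tacitly. $\mathbf G(U)(i,j)$ is the set of morphisms $i\to j$ in $\mathbf G(U)$. For $i,j\in\operatorname{Ob}\mathbf G(U)$, $\mathbf G(i,j)$ is the presheaf $V\mapsto\mathbf G(V)(i|_V,j|_V)$ on $U$. For objects over different open sets $U,V$, $\mathbf G(i,j)$ denotes the corresponding presheaf on $U\cap V$, and restriction signs are omitted. $\mathbf G$ is a stack if all presheaves $\mathbf G(i,j)$ are sheaves and descent data for objects are effective. A gerbe is a stack of groupoids that is locally nonempty (each $x\in X$ has an open neighborhood $U$ with $\operatorname{Ob}\mathbf G(U)\ne\emptyset$) and locally connected (for $i,j\in\operatorname{Ob}\mathbf G(U)$ and $x\in U$ there is an open $V$ with $x\in V\subset U$ and $\mathbf G(V)(i,j)\neq\emptyset$). Morphisms of gerbes are pseudonatural transformations. For $g\in \mathbf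 G(i,j)(W)$, $\operatorname{Ad}(g)(f)=g\circ f\circ g^{-1}$. A local object is an object of $\mathbf G(U)$ for some open $U\subset X$. **Weak epimorphism.** A morphism of gerbes $F:\mathbf G\to\mathbf H$ is a weak epimorphism if (i) for every open $U$, $j\in\operatorname{Ob}\mathbf H(U)$ and $x\in U$ there are an open $V$ with $x\in V\subset U$, an object $i\in\operatorname{Ob}\mathbf G(V)$ and an isomorphism $F(i)\to j|_V$ in $\mathbf H(V)$; and (ii) for all $i,j\in\operatorname{Ob}\mathbf G(U)$ the map of sheaves $\mathbf G(i,j)\to\mathbf H(F(i),F(j))$ is surjective. **Central extension.** A central extension of gerbes $1\to\mathcal N\to\mathbf G\xrightarrow{F}\mathbf H\to1$ consists of gerbes $\mathbf G,\mathbf H$, a weak epimorphism $F$ such that for every local object $i$ of $\mathbf G$ the sheaf $\operatorname{Ker}(F:\mathbf G(i,i)\to\mathbf H(F(i),F(i)))$ lies in the center of $\mathbf G(i,i)$, and a sheaf of abelian groups $\mathcal N$ on $X$ (written multiplicatively, with unit $1$) together with isomorphisms of sheaves of groups $\chi_i:\mathcal N|_U\to\operatorname{Ker}(\mathbf G(i,i)\to\mathbf H(F(i),F(i)))$ for $i\in\operatorname{Ob}\mathbf G(U)$, satisfying $\operatorname{Ad}(g)\circ\chi_i=\chi_j$ on $W$ for every $g\in\mathbf G(i,j)(W)$. The $\chi_i$ are used to regard $\mathcal N|_U$ as a subsheaf of $\mathbf G(i,i)$. Here the center of a sheaf of groups $\mathcal G$ is $\mathrm Z(\mathcal G)(U)=\{g\in\mathcal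 G(U): g|_V\in\mathrm Z(\mathcal G(V))\ \forall V\subset U\}$. **The class $\operatorname{cl}^1_F(h)$.** $\check{\mathrm H}^p(X,\mathcal N)$ is Čech cohomology (the direct limit over open coverings). Write $U_{k_0,\dots,k_m}=U_{k_0}\cap\dots\cap U_{k_m}$. Given $i,j\in\operatorname{Ob}\mathbf G(X)$ and $h\in\mathbf H(X)(F(i),F(j))$, choose an open covering $\{U_k\}_{k\in K}$ of $X$ and isomorphisms $g_k\in\mathbf G(U_k)(i,j)$ with $F(g_k)=h|_{U_k}$ (these exist since $F$ is a weak epimorphism). The elements $g_{k_0,k_1}:=g_{k_1}^{-1}\circ g_{k_0}\in\mathbf G(U_{k_0,k_1})(i,i)$ lie in $\mathcal N(U_{k_0,k_1})$ and form a Čech $1$-cocycle. $\operatorname{cl}^1_F(h)\in\check{\mathrm H}^1(X,\mathcal N)$ is its class, which is independent of the choices. *)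

theory Defs
  imports "HOL-Analysis.Abstract_Topology" "HOL-Algebra.Product_Groups"
begin

section \<open>Groupoids\<close>

record ('o, 'm) cat =
  Obj :: "'o set"
  Arr :: "'m set"
  Src :: "'m \<Rightarrow> 'o"
  Tgt :: "'m \<Rightarrow> 'o"
  Ident :: "'o \<Rightarrow> 'm"
  Comp :: "'m \<Rightarrow> 'm \<Rightarrow> 'm"  (infixl \<open>\<cdot>\<index>\<close> 70)

definition Hom :: "('o, 'm) cat \<Rightarrow> 'o \<Rightarrow> 'o \<Rightarrow> 'm set" where
  "Hom C i j = {f \<in> Arr C. Src C f = i \<and> Tgt C f = j}"

locale category =
  fixes C :: "('o, 'm) cat" (structure)
  assumes src_tgt: "f \<in> Arr C \<Longrightarrow> Src C f \<in> Obj C \<and> Tgt C f \<in> Obj C"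
    and ident: "i \<in> Obj C \<Longrightarrow> Ident C i \<in> Hom C i i"
    and comp: "f \<in> Hom C i j \<Longrightarrow> g \<in> Hom C j k \<Longrightarrow> g \<cdot> f \<in> Hom C i k"
    and ident_left: "f \<in> Hom C i j \<Longrightarrow> Ident C j \<cdot> f = f"
    and ident_right: "f \<in> Hom C i j \<Longrightarrow> f \<cdot> Ident C i = f"
    and comp_assoc: "f \<in> Hom C i j \<Longrightarrow> g \<in> Hom C j k \<Longrightarrow> h \<in> Hom C k l
      \<Longrightarrow> (h \<cdot> g) \<cdot> f = h \<cdot> (g \<cdot> f)"

definition inverse_arrows :: "('o, 'm) cat \<Rightarrow> 'm \<Rightarrow> 'm \<Rightarrow> bool" where
  "inverse_arrows C f g \<longleftrightarrow>
     f \<in> Arr C \<and> g \<in> Hom C (Tgt C f) (Src C f) \<and>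
     g \<cdot>\<^bsub>C\<^esub> f = Ident C (Src C f) \<and> f \<cdot>\<^bsub>C\<^esub> g = Ident C (Tgt C f)"

definition arr_inv :: "('o, 'm) cat \<Rightarrow> 'm \<Rightarrow> 'm" where
  "arr_inv C f = (THE g. inverse_arrows C f g)"

locale groupoid = category +
  assumes invertible: "f \<in> Arr C \<Longrightarrow> \<exists>g. inverse_arrows C f g"

locale cat_functor = C: category C + D: category D
  for C :: "('o, 'm) cat" and D :: "('p, 'n) cat"
    and Fo :: "'o \<Rightarrow> 'p" and Fm :: "'m \<Rightarrow> 'n" +
  assumes obj: "i \<in> Obj C \<Longrightarrow> Fo i \<in> Obj D"
    and arr: "f \<in> Hom C i j \<Longrightarrow> Fm f \<in> Hom D (Fo i) (Fo j)"
    and pres_ident: "i \<in> Obj C \<Longrightarrow> Fm (Ident C i) = Ident D (Fo i)"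
    and pres_comp: "f \<in> Hom C i j \<Longrightarrow> g \<in> Hom C j k
      \<Longrightarrow> Fm (g \<cdot>\<^bsub>C\<^esub> f) = Fm g \<cdot>\<^bsub>D\<^esub> Fm f"


section \<open>Open coverings and sheaves\<close>

text \<open>A family \<open>{U\<^sub>k}\<close>, \<open>k \<in> K\<close>, is the pair \<open>(K, U)\<close>.  Where coverings are quantified over in a
  definition, the index type is \<^typ>\<open>'x set\<close>: every open covering and the set of its members,
  indexed by themselves, refine each other, so this index type is large enough.\<close>

type_synonym ('k, 'x) cover = "'k set \<times> ('k \<Rightarrow> 'x set)"

definition open_covering :: "'x topology \<Rightarrow> 'x set \<Rightarrow> ('k, 'x) cover \<Rightarrow> bool" where
  "open_covering X V = (\<lambda>(K, U). (\<forall>k\<in>K. openin X (U k)) \<and> (\<Union>k\<in>K. U k) = V)"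

text \<open>In all restriction maps \<open>r U V\<close> the first argument is the larger open set.\<close>

locale presheaf =
  fixes X :: "'x topology" and S :: "'x set \<Rightarrow> 's set" and r :: "'x set \<Rightarrow> 'x set \<Rightarrow> 's \<Rightarrow> 's"
  assumes res: "openin X U \<Longrightarrow> openin X V \<Longrightarrow> V \<subseteq> U \<Longrightarrow> s \<in> S U \<Longrightarrow> r U V s \<in> S V"
    and res_id: "openin X U \<Longrightarrow> s \<in> S U \<Longrightarrow> r U U s = s"
    and res_res: "openin X U \<Longrightarrow> openin X V \<Longrightarrow> openin X W \<Longrightarrow> W \<subseteq> V \<Longrightarrow> V \<subseteq> U \<Longrightarrow> s \<in> S U
      \<Longrightarrow> r V W (r U V s) = r U W s"

locale sheaf = presheaf X S r
  for X :: "'x topology" and S :: "'x set \<Rightarrow> 's set" and r :: "'x set \<Rightarrow> 'x set \<Rightarrow> 's \<Rightarrow> 's" +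
  assumes glue: "\<And>V (K :: 'x set set) U s.
      openin X V \<Longrightarrow> open_covering X V (K, U) \<Longrightarrow> \<forall>k\<in>K. s k \<in> S (U k)
      \<Longrightarrow> \<forall>k\<in>K. \<forall>l\<in>K. r (U k) (U k \<inter> U l) (s k) = r (U l) (U k \<inter> U l) (s l)
      \<Longrightarrow> \<exists>!t. t \<in> S V \<and> (\<forall>k\<in>K. r V (U k) t = s k)"

record ('x, 'n) group_presheaf =
  Sec :: "'x set \<Rightarrow> 'n monoid"
  Res :: "'x set \<Rightarrow> 'x set \<Rightarrow> 'n \<Rightarrow> 'n"

locale abelian_group_sheaf = sheaf X "\<lambda>U. carrier (Sec N U)" "Res N"
  for X :: "'x topology" and N :: "('x, 'n) group_presheaf" +
  assumes sec_group: "openin X U \<Longrightarrow> comm_group (Sec N U)"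
    and res_hom: "openin X U \<Longrightarrow> openin X V \<Longrightarrow> V \<subseteq> U
      \<Longrightarrow> Res N U V \<in> hom (Sec N U) (Sec N V)"

definition group_center :: "('a, 'b) monoid_scheme \<Rightarrow> 'a set" where
  "group_center A = {a \<in> carrier A. \<forall>b\<in>carrier A. a \<otimes>\<^bsub>A\<^esub> b = b \<otimes>\<^bsub>A\<^esub> a}"

definition sheaf_center ::
  "'x topology \<Rightarrow> ('x set \<Rightarrow> 'a monoid) \<Rightarrow> ('x set \<Rightarrow> 'x set \<Rightarrow> 'a \<Rightarrow> 'a) \<Rightarrow> 'x set \<Rightarrow> 'a set" where
  "sheaf_center X A r U =
     {a \<in> carrier (A U). \<forall>V. openin X V \<and> V \<subseteq> U \<longrightarrow> r U V a \<in> group_center (A V)}"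


section \<open>Prestacks, stacks and gerbes\<close>

text \<open>The pseudofunctor data.  \<open>CompIso G U V W i\<close> is the coherence arrow
  \<open>(i|\<^sub>V)|\<^sub>W \<rightarrow> i|\<^sub>W\<close> and \<open>UnitIso G U i\<close> the coherence arrow \<open>i|\<^sub>U \<rightarrow> i\<close>, for \<open>i\<close> over \<open>U\<close>;
  both are invertible because all categories involved are groupoids.\<close>

record ('x, 'o, 'm) prestack =
  Cat :: "'x set \<Rightarrow> ('o, 'm) cat"
  ResO :: "'x set \<Rightarrow> 'x set \<Rightarrow> 'o \<Rightarrow> 'o"
  ResM :: "'x set \<Rightarrow> 'x set \<Rightarrow> 'm \<Rightarrow> 'm"
  CompIso :: "'x set \<Rightarrow> 'x set \<Rightarrow> 'x set \<Rightarrow> 'o \<Rightarrow> 'm"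
  UnitIso :: "'x set \<Rightarrow> 'o \<Rightarrow> 'm"

locale groupoid_prestack =
  fixes X :: "'x topology" and G :: "('x, 'o, 'm) prestack"
  assumes groupoid: "openin X U \<Longrightarrow> groupoid (Cat G U)"
    and functor_res: "openin X U \<Longrightarrow> openin X V \<Longrightarrow> V \<subseteq> U
      \<Longrightarrow> cat_functor (Cat G U) (Cat G V) (ResO G U V) (ResM G U V)"
    and comp_iso: "openin X U \<Longrightarrow> openin X V \<Longrightarrow> openin X W \<Longrightarrow> W \<subseteq> V \<Longrightarrow> V \<subseteq> U
      \<Longrightarrow> i \<in> Obj (Cat G U)
      \<Longrightarrow> CompIso G U V W i \<in> Hom (Cat G W) (ResO G V W (ResO G U V i)) (ResO G U W i)"
    and comp_iso_natural: "openin X U \<Longrightarrow> openin X V \<Longrightarrow> openin X W \<Longrightarrow> W \<subseteq> V \<Longrightarrow> V \<subseteq> U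
      \<Longrightarrow> f \<in> Hom (Cat G U) i j
      \<Longrightarrow> CompIso G U V W j \<cdot>\<^bsub>Cat G W\<^esub> ResM G V W (ResM G U V f)
          = ResM G U W f \<cdot>\<^bsub>Cat G W\<^esub> CompIso G U V W i"
    and unit_iso: "openin X U \<Longrightarrow> i \<in> Obj (Cat G U)
      \<Longrightarrow> UnitIso G U i \<in> Hom (Cat G U) (ResO G U U i) i"
    and unit_iso_natural: "openin X U \<Longrightarrow> f \<in> Hom (Cat G U) i j
      \<Longrightarrow> UnitIso G U j \<cdot>\<^bsub>Cat G U\<^esub> ResM G U U f = f \<cdot>\<^bsub>Cat G U\<^esub> UnitIso G U i"
    and coherence_comp: "openin X U \<Longrightarrow> openin X V \<Longrightarrow> openin X W \<Longrightarrow> openin X T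
      \<Longrightarrow> T \<subseteq> W \<Longrightarrow> W \<subseteq> V \<Longrightarrow> V \<subseteq> U \<Longrightarrow> i \<in> Obj (Cat G U)
      \<Longrightarrow> CompIso G U W T i \<cdot>\<^bsub>Cat G T\<^esub> ResM G W T (CompIso G U V W i)
          = CompIso G U V T i \<cdot>\<^bsub>Cat G T\<^esub> CompIso G V W T (ResO G U V i)"
    and coherence_unit_outer: "openin X U \<Longrightarrow> openin X V \<Longrightarrow> V \<subseteq> U \<Longrightarrow> i \<in> Obj (Cat G U)
      \<Longrightarrow> CompIso G U V V i = UnitIso G V (ResO G U V i)"
    and coherence_unit_inner: "openin X U \<Longrightarrow> openin X V \<Longrightarrow> V \<subseteq> U \<Longrightarrow> i \<in> Obj (Cat G U)
      \<Longrightarrow> CompIso G U U V i = ResM G U V (UnitIso G U i)"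

text \<open>The presheaf \<open>\<^bold>G(i, j)\<close> on \<open>U \<inter> U'\<close> for \<open>i\<close> over \<open>U\<close> and \<open>j\<close> over \<open>U'\<close>: its sections over \<open>V\<close>
  and its restriction maps, in which the coherence arrows are made explicit.\<close>

definition HomSec :: "('x, 'o, 'm) prestack \<Rightarrow> 'x set \<Rightarrow> 'o \<Rightarrow> 'x set \<Rightarrow> 'o \<Rightarrow> 'x set \<Rightarrow> 'm set" where
  "HomSec G U i U' j V = Hom (Cat G V) (ResO G U V i) (ResO G U' V j)"

definition HomRes ::
  "('x, 'o, 'm) prestack \<Rightarrow> 'x set \<Rightarrow> 'o \<Rightarrow> 'x set \<Rightarrow> 'o \<Rightarrow> 'x set \<Rightarrow> 'x set \<Rightarrow> 'm \<Rightarrow> 'm" where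
  "HomRes G U i U' j V W f =
     CompIso G U' V W j \<cdot>\<^bsub>Cat G W\<^esub> ResM G V W f \<cdot>\<^bsub>Cat G W\<^esub> arr_inv (Cat G W) (CompIso G U V W i)"

definition Aut :: "('x, 'o, 'm) prestack \<Rightarrow> 'x set \<Rightarrow> 'o \<Rightarrow> 'x set \<Rightarrow> 'm monoid" where
  "Aut G U i V =
     \<lparr>carrier = HomSec G U i U i V,
      monoid.mult = (\<lambda>g f. g \<cdot>\<^bsub>Cat G V\<^esub> f),
      one = Ident (Cat G V) (ResO G U V i)\<rparr>"

definition descent_datum ::
  "'x topology \<Rightarrow> ('x, 'o, 'm) prestack \<Rightarrow> 'x set \<Rightarrow> ('k, 'x) cover
     \<Rightarrow> ('k \<Rightarrow> 'o) \<Rightarrow> ('k \<Rightarrow> 'k \<Rightarrow> 'm) \<Rightarrow> bool" where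
  "descent_datum X G V = (\<lambda>(K, U) i g.
     open_covering X V (K, U) \<and>
     (\<forall>k\<in>K. i k \<in> Obj (Cat G (U k))) \<and>
     (\<forall>k\<in>K. \<forall>l\<in>K. g k l \<in> HomSec G (U k) (i k) (U l) (i l) (U k \<inter> U l)) \<and>
     (\<forall>k\<in>K. \<forall>l\<in>K. \<forall>m\<in>K. let W = U k \<inter> U l \<inter> U m in
        HomRes G (U l) (i l) (U m) (i m) (U l \<inter> U m) W (g l m)
          \<cdot>\<^bsub>Cat G W\<^esub> HomRes G (U k) (i k) (U l) (i l) (U k \<inter> U l) W (g k l)
        = HomRes G (U k) (i k) (U m) (i m) (U k \<inter> U m) W (g k m)))"

definition effective ::
  "('x, 'o, 'm) prestack \<Rightarrow> 'x set \<Rightarrow> ('k, 'x) cover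
     \<Rightarrow> ('k \<Rightarrow> 'o) \<Rightarrow> ('k \<Rightarrow> 'k \<Rightarrow> 'm) \<Rightarrow> bool" where
  "effective G V = (\<lambda>(K, U) i g.
     \<exists>j\<in>Obj (Cat G V). \<exists>f.
       (\<forall>k\<in>K. f k \<in> HomSec G V j (U k) (i k) (U k)) \<and>
       (\<forall>k\<in>K. \<forall>l\<in>K. let W = U k \<inter> U l in
          g k l \<cdot>\<^bsub>Cat G W\<^esub> HomRes G V j (U k) (i k) (U k) W (f k)
          = HomRes G V j (U l) (i l) (U l) W (f l)))"

locale groupoid_stack = groupoid_prestack X G
  for X :: "'x topology" and G :: "('x, 'o, 'm) prestack" +
  assumes hom_sheaf: "openin X U \<Longrightarrow> i \<in> Obj (Cat G U) \<Longrightarrow> j \<in> Obj (Cat G U)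
      \<Longrightarrow> sheaf (subtopology X U) (HomSec G U i U j) (HomRes G U i U j)"
    and descent: "\<And>V (\<U> :: ('x set, 'x) cover) i g.
      openin X V \<Longrightarrow> descent_datum X G V \<U> i g \<Longrightarrow> effective G V \<U> i g"

locale gerbe = groupoid_stack X G
  for X :: "'x topology" and G :: "('x, 'o, 'm) prestack" +
  assumes locally_nonempty: "x \<in> topspace X
      \<Longrightarrow> \<exists>U. openin X U \<and> x \<in> U \<and> Obj (Cat G U) \<noteq> {}"
    and locally_connected: "openin X U \<Longrightarrow> i \<in> Obj (Cat G U) \<Longrightarrow> j \<in> Obj (Cat G U) \<Longrightarrow> x \<in> U
      \<Longrightarrow> \<exists>V. openin X V \<and> x \<in> V \<and> V \<subseteq> U \<and> HomSec G U i U j V \<noteq> {}"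


section \<open>Morphisms of gerbes\<close>

text \<open>\<open>MorIso F U V i\<close> is the pseudonaturality arrow \<open>F(i|\<^sub>V) \<rightarrow> F(i)|\<^sub>V\<close>, for \<open>i\<close> over \<open>U\<close>.\<close>

record ('x, 'o, 'm, 'p, 'n) prestack_map =
  MorO :: "'x set \<Rightarrow> 'o \<Rightarrow> 'p"
  MorM :: "'x set \<Rightarrow> 'm \<Rightarrow> 'n"
  MorIso :: "'x set \<Rightarrow> 'x set \<Rightarrow> 'o \<Rightarrow> 'n"

locale gerbe_morphism = G: gerbe X G + H: gerbe X H
  for X :: "'x topology" and G :: "('x, 'o, 'm) prestack" and H :: "('x, 'p, 'n) prestack"
    and F :: "('x, 'o, 'm, 'p, 'n) prestack_map" +
  assumes functor_mor: "openin X U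
      \<Longrightarrow> cat_functor (Cat G U) (Cat H U) (MorO F U) (MorM F U)"
    and mor_iso: "openin X U \<Longrightarrow> openin X V \<Longrightarrow> V \<subseteq> U \<Longrightarrow> i \<in> Obj (Cat G U)
      \<Longrightarrow> MorIso F U V i \<in> Hom (Cat H V) (MorO F V (ResO G U V i)) (ResO H U V (MorO F U i))"
    and mor_iso_natural: "openin X U \<Longrightarrow> openin X V \<Longrightarrow> V \<subseteq> U \<Longrightarrow> f \<in> Hom (Cat G U) i j
      \<Longrightarrow> MorIso F U V j \<cdot>\<^bsub>Cat H V\<^esub> MorM F V (ResM G U V f)
          = ResM H U V (MorM F U f) \<cdot>\<^bsub>Cat H V\<^esub> MorIso F U V i"
    and mor_iso_comp: "openin X U \<Longrightarrow> openin X V \<Longrightarrow> openin X W \<Longrightarrow> W \<subseteq> V \<Longrightarrow> V \<subseteq> U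
      \<Longrightarrow> i \<in> Obj (Cat G U)
      \<Longrightarrow> CompIso H U V W (MorO F U i) \<cdot>\<^bsub>Cat H W\<^esub> ResM H V W (MorIso F U V i)
            \<cdot>\<^bsub>Cat H W\<^esub> MorIso F V W (ResO G U V i)
          = MorIso F U W i \<cdot>\<^bsub>Cat H W\<^esub> MorM F W (CompIso G U V W i)"
    and mor_iso_unit: "openin X U \<Longrightarrow> i \<in> Obj (Cat G U)
      \<Longrightarrow> UnitIso H U (MorO F U i) \<cdot>\<^bsub>Cat H U\<^esub> MorIso F U U i = MorM F U (UnitIso G U i)"

text \<open>The map \<open>\<^bold>G(i, j)(V) \<rightarrow> \<^bold>H(F(i), F(j))(V)\<close> for \<open>i\<close> over \<open>U\<close> and \<open>j\<close> over \<open>U'\<close>.\<close>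

definition HomMap ::
  "('x, 'p, 'n) prestack \<Rightarrow> ('x, 'o, 'm, 'p, 'n) prestack_map
     \<Rightarrow> 'x set \<Rightarrow> 'o \<Rightarrow> 'x set \<Rightarrow> 'o \<Rightarrow> 'x set \<Rightarrow> 'm \<Rightarrow> 'n" where
  "HomMap H F U i U' j V f =
     MorIso F U' V j \<cdot>\<^bsub>Cat H V\<^esub> MorM F V f \<cdot>\<^bsub>Cat H V\<^esub> arr_inv (Cat H V) (MorIso F U V i)"

text \<open>Surjectivity of a map of sheaves means that sections lift locally.\<close>

locale weak_epimorphism = gerbe_morphism X G H F
  for X :: "'x topology" and G :: "('x, 'o, 'm) prestack" and H :: "('x, 'p, 'n) prestack"
    and F :: "('x, 'o, 'm, 'p, 'n) prestack_map" +
  assumes locally_ess_surj: "openin X U \<Longrightarrow> y \<in> Obj (Cat H U) \<Longrightarrow> x \<in> U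
      \<Longrightarrow> \<exists>V. openin X V \<and> x \<in> V \<and> V \<subseteq> U \<and>
            (\<exists>i\<in>Obj (Cat G V). Hom (Cat H V) (MorO F V i) (ResO H U V y) \<noteq> {})"
    and hom_surj: "openin X U \<Longrightarrow> i \<in> Obj (Cat G U) \<Longrightarrow> j \<in> Obj (Cat G U)
      \<Longrightarrow> openin X V \<Longrightarrow> V \<subseteq> U \<Longrightarrow> h \<in> HomSec H U (MorO F U i) U (MorO F U j) V \<Longrightarrow> x \<in> V
      \<Longrightarrow> \<exists>W. openin X W \<and> x \<in> W \<and> W \<subseteq> V \<and>
            (\<exists>g\<in>HomSec G U i U j W.
               HomMap H F U i U j W g = HomRes H U (MorO F U i) U (MorO F U j) V W h)"

definition Ker :: "('x, 'o, 'm) prestack \<Rightarrow> ('x, 'p, 'n) prestack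
     \<Rightarrow> ('x, 'o, 'm, 'p, 'n) prestack_map \<Rightarrow> 'x set \<Rightarrow> 'o \<Rightarrow> 'x set \<Rightarrow> 'm set" where
  "Ker G H F U i V = kernel (Aut G U i V) (Aut H U (MorO F U i) V) (HomMap H F U i U i V)"


section \<open>Central extensions\<close>

text \<open>For \<open>i\<close> over \<open>U\<close>, \<open>\<chi> U i V\<close> is the component of \<open>\<chi>\<^sub>i\<close> over \<open>V \<subseteq> U\<close>.\<close>

locale central_extension = weak_epimorphism X G H F + N: abelian_group_sheaf X N
  for X :: "'x topology" and N :: "('x, 'a) group_presheaf"
    and \<chi> :: "'x set \<Rightarrow> 'o \<Rightarrow> 'x set \<Rightarrow> 'a \<Rightarrow> 'm"
    and G :: "('x, 'o, 'm) prestack" and F :: "('x, 'o, 'm, 'p, 'n) prestack_map"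
    and H :: "('x, 'p, 'n) prestack" +
  assumes central: "openin X U \<Longrightarrow> i \<in> Obj (Cat G U) \<Longrightarrow> openin X V \<Longrightarrow> V \<subseteq> U
      \<Longrightarrow> Ker G H F U i V \<subseteq> sheaf_center (subtopology X U) (Aut G U i) (HomRes G U i U i) V"
    and chi_iso: "openin X U \<Longrightarrow> i \<in> Obj (Cat G U) \<Longrightarrow> openin X V \<Longrightarrow> V \<subseteq> U
      \<Longrightarrow> \<chi> U i V \<in> iso (Sec N V) ((Aut G U i V)\<lparr>carrier := Ker G H F U i V\<rparr>)"
    and chi_res: "openin X U \<Longrightarrow> i \<in> Obj (Cat G U) \<Longrightarrow> openin X V \<Longrightarrow> openin X W
      \<Longrightarrow> W \<subseteq> V \<Longrightarrow> V \<subseteq> U \<Longrightarrow> n \<in> carrier (Sec N V)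
      \<Longrightarrow> \<chi> U i W (Res N V W n) = HomRes G U i U i V W (\<chi> U i V n)"
    and Ad_chi: "openin X U \<Longrightarrow> i \<in> Obj (Cat G U) \<Longrightarrow> openin X U' \<Longrightarrow> j \<in> Obj (Cat G U')
      \<Longrightarrow> openin X W \<Longrightarrow> W \<subseteq> U \<inter> U' \<Longrightarrow> g \<in> HomSec G U i U' j W
      \<Longrightarrow> openin X V \<Longrightarrow> V \<subseteq> W \<Longrightarrow> n \<in> carrier (Sec N V)
      \<Longrightarrow> HomRes G U i U' j W V g \<cdot>\<^bsub>Cat G V\<^esub> \<chi> U i V n
            \<cdot>\<^bsub>Cat G V\<^esub> arr_inv (Cat G V) (HomRes G U i U' j W V g)
          = \<chi> U' j V n"


section \<open>Cech cohomology in degree one\<close>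

definition cech_C0 :: "('x, 'n) group_presheaf \<Rightarrow> ('k, 'x) cover \<Rightarrow> ('k \<Rightarrow> 'n) monoid" where
  "cech_C0 N = (\<lambda>(K, U). product_group K (\<lambda>k. Sec N (U k)))"

definition cech_C1 :: "('x, 'n) group_presheaf \<Rightarrow> ('k, 'x) cover \<Rightarrow> ('k \<times> 'k \<Rightarrow> 'n) monoid" where
  "cech_C1 N = (\<lambda>(K, U). product_group (K \<times> K) (\<lambda>(k, l). Sec N (U k \<inter> U l)))"

definition cech_C2 :: "('x, 'n) group_presheaf \<Rightarrow> ('k, 'x) cover \<Rightarrow> ('k \<times> 'k \<times> 'k \<Rightarrow> 'n) monoid" where
  "cech_C2 N = (\<lambda>(K, U). product_group (K \<times> K \<times> K) (\<lambda>(k, l, m). Sec N (U k \<inter> U l \<inter> U m)))"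

definition cech_d0 :: "('x, 'n) group_presheaf \<Rightarrow> ('k, 'x) cover \<Rightarrow> ('k \<Rightarrow> 'n) \<Rightarrow> 'k \<times> 'k \<Rightarrow> 'n" where
  "cech_d0 N = (\<lambda>(K, U) b.
     restrict (\<lambda>(k, l). let W = U k \<inter> U l in
       Res N (U l) W (b l) \<otimes>\<^bsub>Sec N W\<^esub> inv\<^bsub>Sec N W\<^esub> Res N (U k) W (b k)) (K \<times> K))"

definition cech_d1 ::
  "('x, 'n) group_presheaf \<Rightarrow> ('k, 'x) cover \<Rightarrow> ('k \<times> 'k \<Rightarrow> 'n) \<Rightarrow> 'k \<times> 'k \<times> 'k \<Rightarrow> 'n" where
  "cech_d1 N = (\<lambda>(K, U) c.
     restrict (\<lambda>(k, l, m). let W = U k \<inter> U l \<inter> U m in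
       Res N (U l \<inter> U m) W (c (l, m))
       \<otimes>\<^bsub>Sec N W\<^esub> inv\<^bsub>Sec N W\<^esub> Res N (U k \<inter> U m) W (c (k, m))
       \<otimes>\<^bsub>Sec N W\<^esub> Res N (U k \<inter> U l) W (c (k, l))) (K \<times> K \<times> K))"

definition cech_Z1 :: "('x, 'n) group_presheaf \<Rightarrow> ('k, 'x) cover \<Rightarrow> ('k \<times> 'k \<Rightarrow> 'n) monoid" where
  "cech_Z1 N \<U> = (cech_C1 N \<U>)\<lparr>carrier := kernel (cech_C1 N \<U>) (cech_C2 N \<U>) (cech_d1 N \<U>)\<rparr>"

definition cech_B1 :: "('x, 'n) group_presheaf \<Rightarrow> ('k, 'x) cover \<Rightarrow> ('k \<times> 'k \<Rightarrow> 'n) set" where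
  "cech_B1 N \<U> = cech_d0 N \<U> ` carrier (cech_C0 N \<U>)"

definition cover_H1 :: "('x, 'n) group_presheaf \<Rightarrow> ('k, 'x) cover \<Rightarrow> ('k \<times> 'k \<Rightarrow> 'n) set monoid" where
  "cover_H1 N \<U> = cech_Z1 N \<U> Mod cech_B1 N \<U>"

text \<open>\<open>\<tau>\<close> exhibits the second covering as a refinement of the first.\<close>

definition refinement :: "('k, 'x) cover \<Rightarrow> ('l, 'x) cover \<Rightarrow> ('l \<Rightarrow> 'k) \<Rightarrow> bool" where
  "refinement = (\<lambda>(K, U) (L, V) \<tau>. \<tau> \<in> L \<rightarrow> K \<and> (\<forall>l\<in>L. V l \<subseteq> U (\<tau> l)))"

definition refine_cochain ::
  "('x, 'n) group_presheaf \<Rightarrow> ('k, 'x) cover \<Rightarrow> ('l, 'x) cover \<Rightarrow> ('l \<Rightarrow> 'k)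
     \<Rightarrow> ('k \<times> 'k \<Rightarrow> 'n) \<Rightarrow> 'l \<times> 'l \<Rightarrow> 'n" where
  "refine_cochain N = (\<lambda>(K, U) (L, V) \<tau> c.
     restrict (\<lambda>(l, m). Res N (U (\<tau> l) \<inter> U (\<tau> m)) (V l \<inter> V m) (c (\<tau> l, \<tau> m))) (L \<times> L))"

definition refine_H1 ::
  "('x, 'n) group_presheaf \<Rightarrow> ('k, 'x) cover \<Rightarrow> ('l, 'x) cover \<Rightarrow> ('l \<Rightarrow> 'k)
     \<Rightarrow> ('k \<times> 'k \<Rightarrow> 'n) set \<Rightarrow> ('l \<times> 'l \<Rightarrow> 'n) set" where
  "refine_H1 N \<U> \<V> \<tau> a = (\<Union>c\<in>a. cech_B1 N \<V> #>\<^bsub>cech_Z1 N \<V>\<^esub> refine_cochain N \<U> \<V> \<tau> c)"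

text \<open>The direct limit of the groups \<^term>\<open>cover_H1 N \<U>\<close>: pairs of a covering and a class,
  identified when they agree on a common refinement.\<close>

type_synonym ('x, 'n) cech_rep = "('x set, 'x) cover \<times> ('x set \<times> 'x set \<Rightarrow> 'n) set"

definition cech_reps :: "'x topology \<Rightarrow> ('x, 'n) group_presheaf \<Rightarrow> ('x, 'n) cech_rep set" where
  "cech_reps X N = {(\<U>, a). open_covering X (topspace X) \<U> \<and> a \<in> carrier (cover_H1 N \<U>)}"

definition cech_rel ::
  "'x topology \<Rightarrow> ('x, 'n) group_presheaf \<Rightarrow> (('x, 'n) cech_rep \<times> ('x, 'n) cech_rep) set" where
  "cech_rel X N = {((\<U>, a), (\<V>, b)).
     (\<U>, a) \<in> cech_reps X N \<and> (\<V>, b) \<in> cech_reps X N \<and>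
     (\<exists>(\<W> :: ('x set, 'x) cover) \<sigma> \<tau>.
        open_covering X (topspace X) \<W> \<and> refinement \<U> \<W> \<sigma> \<and> refinement \<V> \<W> \<tau> \<and>
        refine_H1 N \<U> \<W> \<sigma> a = refine_H1 N \<V> \<W> \<tau> b)}"

definition cech_class ::
  "'x topology \<Rightarrow> ('x, 'n) group_presheaf \<Rightarrow> ('x, 'n) cech_rep \<Rightarrow> ('x, 'n) cech_rep set" where
  "cech_class X N p = cech_rel X N `` {p}"

definition trivial_cover :: "'x topology \<Rightarrow> ('x set, 'x) cover" where
  "trivial_cover X = ({topspace X}, \<lambda>U. U)"

text \<open>Two elements of the limit have representatives over one and the same covering, and these
  are multiplied there.\<close>

definition cech_H1 :: "'x topology \<Rightarrow> ('x, 'n) group_presheaf \<Rightarrow> ('x, 'n) cech_rep set monoid" where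
  "cech_H1 X N =
     \<lparr>carrier = cech_reps X N // cech_rel X N,
      monoid.mult = (\<lambda>\<alpha> \<beta>. \<Union>{cech_class X N (\<U>, a \<otimes>\<^bsub>cover_H1 N \<U>\<^esub> b) | \<U> a b.
                                (\<U>, a) \<in> \<alpha> \<and> (\<U>, b) \<in> \<beta>}),
      one = cech_class X N (trivial_cover X, \<one>\<^bsub>cover_H1 N (trivial_cover X)\<^esub>)\<rparr>"


section \<open>The obstruction class\<close>

definition local_lifts ::
  "'x topology \<Rightarrow> ('x, 'o, 'm) prestack \<Rightarrow> ('x, 'o, 'm, 'p, 'n) prestack_map
     \<Rightarrow> ('x, 'p, 'n) prestack \<Rightarrow> 'o \<Rightarrow> 'o \<Rightarrow> 'n \<Rightarrow> ('k, 'x) cover \<Rightarrow> ('k \<Rightarrow> 'm) \<Rightarrow> bool" where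
  "local_lifts X G F H i j h = (\<lambda>(K, U) g.
     open_covering X (topspace X) (K, U) \<and>
     (\<forall>k\<in>K. g k \<in> HomSec G (topspace X) i (topspace X) j (U k) \<and>
            HomMap H F (topspace X) i (topspace X) j (U k) (g k) = ResM H (topspace X) (U k) h))"

text \<open>The cochain \<open>g\<^sub>l\<^sup>-\<^sup>1 \<circ> g\<^sub>k\<close> on \<open>U\<^sub>k \<inter> U\<^sub>l\<close>, transported to \<open>\<N>\<close> along \<open>\<chi>\<^sub>i\<close>.\<close>

definition lift_cochain ::
  "'x topology \<Rightarrow> ('x, 'a) group_presheaf \<Rightarrow> ('x set \<Rightarrow> 'o \<Rightarrow> 'x set \<Rightarrow> 'a \<Rightarrow> 'm)
     \<Rightarrow> ('x, 'o, 'm) prestack \<Rightarrow> 'o \<Rightarrow> 'o \<Rightarrow> ('k, 'x) cover \<Rightarrow> ('k \<Rightarrow> 'm) \<Rightarrow> 'k \<times> 'k \<Rightarrow> 'a" where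
  "lift_cochain X N \<chi> G i j = (\<lambda>(K, U) g.
     restrict (\<lambda>(k, l). let T = topspace X; W = U k \<inter> U l in
       inv_into (carrier (Sec N W)) (\<chi> T i W)
         (arr_inv (Cat G W) (HomRes G T i T j (U l) W (g l))
            \<cdot>\<^bsub>Cat G W\<^esub> HomRes G T i T j (U k) W (g k))) (K \<times> K))"

definition lift_class ::
  "'x topology \<Rightarrow> ('x, 'a) group_presheaf \<Rightarrow> ('x set \<Rightarrow> 'o \<Rightarrow> 'x set \<Rightarrow> 'a \<Rightarrow> 'm)
     \<Rightarrow> ('x, 'o, 'm) prestack \<Rightarrow> 'o \<Rightarrow> 'o \<Rightarrow> ('x set, 'x) cover \<Rightarrow> ('x set \<Rightarrow> 'm)
     \<Rightarrow> ('x, 'a) cech_rep set" where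
  "lift_class X N \<chi> G i j \<U> g =
     cech_class X N (\<U>, cech_B1 N \<U> #>\<^bsub>cech_Z1 N \<U>\<^esub> lift_cochain X N \<chi> G i j \<U> g)"

definition cl1 ::
  "'x topology \<Rightarrow> ('x, 'a) group_presheaf \<Rightarrow> ('x set \<Rightarrow> 'o \<Rightarrow> 'x set \<Rightarrow> 'a \<Rightarrow> 'm)
     \<Rightarrow> ('x, 'o, 'm) prestack \<Rightarrow> ('x, 'o, 'm, 'p, 'n) prestack_map \<Rightarrow> ('x, 'p, 'n) prestack
     \<Rightarrow> 'o \<Rightarrow> 'o \<Rightarrow> 'n \<Rightarrow> ('x, 'a) cech_rep set" where
  "cl1 X N \<chi> G F H i j h =
     (let (\<U>, g) = (SOME (\<U>, g). local_lifts X G F H i j h \<U> g)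
      in lift_class X N \<chi> G i j \<U> g)"

end

theory Submission
  imports Defs
begin

text \<open>
  Two local lifts of \<open>h\<close> differ by a unique section of \<open>\<N>\<close>, so the local lifts of \<open>h\<close> form a torsor
  under \<open>\<N>\<close>, and \<open>g\<^sub>l \<cdot> c\<^sub>k\<^sub>l = g\<^sub>k\<close> on overlaps for the cochain \<open>c\<close> of a family of local lifts.  If \<open>f\<close> is a
  global lift and \<open>f = g\<^sub>k \<cdot> b\<^sub>k\<close>, then \<open>c\<close> is the coboundary of \<open>b\<close>.  Conversely, if \<open>c\<close> becomes the
  coboundary of \<open>b\<close> on a refinement, the corrected lifts \<open>g\<^sub>k \<cdot> b\<^sub>k\<close> agree on overlaps and glue; the
  resulting morphism maps to \<open>h\<close> because it does so locally.
\<close>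

section \<open>Groupoids and restriction of morphisms\<close>

text \<open>Two features of the setting shape the argument. Restriction is only pseudofunctorial: a
  section of the Hom sheaf over the whole space \<open>T\<close> is an arrow from
  \<open>ResO G T T i\<close> to \<open>ResO G T T j\<close>, not from \<open>i\<close> to
  \<open>j\<close>. The sheaf axiom thus never speaks of \<open>f\<close> or \<open>h\<close>
  directly, but of \<open>ResM G T T f\<close> and \<open>ResM H T T h\<close>; the unit arrows make
  this passage bijective. The other obstacle is the direct limit. Equality with the unit is an
  equality of two sets of pairs (covering, class), the unit being given over
  \<open>trivial_cover X\<close>. It is turned into a statement on cochains: some refinement makes
  the cochain a coboundary. The sign of the coboundary fits the order of composition: from
  \<open>g k \<cdot> b k = g l \<cdot> b l\<close> and \<open>g l \<cdot> c (k, l) = g k\<close>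
  follows \<open>c (k, l) \<otimes> b k = b l\<close>, and \<open>b l \<otimes> inv (b k)\<close> is
  the value of \<open>cech_d0\<close>. Both directions hold for an arbitrary family of local lifts,
  hence for the one that \<open>cl1\<close> selects.\<close>

lemma (in category) Hom_Obj: "f \<in> Hom C i j \<Longrightarrow> i \<in> Obj C \<and> j \<in> Obj C"
  using src_tgt by (auto simp: Hom_def)

context groupoid
begin

lemma inverse_arrows_unique:
  assumes "inverse_arrows C f g" "inverse_arrows C f g'"
  shows "g = g'"
proof -
  let ?i = "Src C f" and ?j = "Tgt C f"
  have f: "f \<in> Hom C ?i ?j" and g: "g \<in> Hom C ?j ?i" and g': "g' \<in> Hom C ?j ?i"
    using assms by (auto simp: inverse_arrows_def Hom_def)
  have "g = g \<cdot> (f \<cdot> g')"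
    using assms(2) ident_right[OF g] by (simp add: inverse_arrows_def)
  also have "\<dots> = (g \<cdot> f) \<cdot> g'"
    using comp_assoc[OF g' f g] by simp
  also have "\<dots> = g'"
    using assms(1) ident_left[OF g'] by (simp add: inverse_arrows_def)
  finally show ?thesis .
qed

lemma inverse_arrows_arr_inv: "f \<in> Arr C \<Longrightarrow> inverse_arrows C f (arr_inv C f)"
  unfolding arr_inv_def using invertible inverse_arrows_unique by (blast intro: theI')

lemma
  assumes "f \<in> Hom C i j"
  shows arr_inv_Hom: "arr_inv C f \<in> Hom C j i"
    and arr_inv_left: "arr_inv C f \<cdot> f = Ident C i"
    and arr_inv_right: "f \<cdot> arr_inv C f = Ident C j"
  using inverse_arrows_arr_inv[of f] assms by (auto simp: inverse_arrows_def Hom_def)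

lemma comp_arr_inv_cancel:
  assumes f: "f \<in> Hom C i k" and e: "e \<in> Hom C i j"
  shows "f \<cdot> arr_inv C e \<cdot> e = f"
  using comp_assoc[OF e arr_inv_Hom[OF e] f] arr_inv_left[OF e] ident_right[OF f] by simp

lemma arr_inv_comp_cancel:
  assumes f: "f \<in> Hom C k j" and e: "e \<in> Hom C i j"
  shows "e \<cdot> (arr_inv C e \<cdot> f) = f"
  using comp_assoc[OF f arr_inv_Hom[OF e] e] arr_inv_right[OF e] ident_left[OF f] by simp

lemma cancel_right:
  assumes f: "f \<in> Hom C j k" "f' \<in> Hom C j k" and e: "e \<in> Hom C i j" and eq: "f \<cdot> e = f' \<cdot> e"
  shows "f = f'"
  using comp_assoc[OF arr_inv_Hom[OF e] e] arr_inv_right[OF e] ident_right f eq by metis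

lemma cancel_left:
  assumes f: "f \<in> Hom C i j" "f' \<in> Hom C i j" and e: "e \<in> Hom C j k" and eq: "e \<cdot> f = e \<cdot> f'"
  shows "f = f'"
  using comp_assoc[OF _ e arr_inv_Hom[OF e]] arr_inv_left[OF e] ident_left f eq by metis

end


section \<open>Restriction of arrows and of sections of Hom presheaves\<close>

context groupoid_prestack
begin

lemma ResO_Obj:
  assumes "openin X U" "openin X V" "V \<subseteq> U" "i \<in> Obj (Cat G U)"
  shows "ResO G U V i \<in> Obj (Cat G V)"
  using assms by (intro cat_functor.obj[OF functor_res])

lemma ResM_Hom:
  assumes "openin X U" "openin X V" "V \<subseteq> U" "f \<in> Hom (Cat G U) i j"
  shows "ResM G U V f \<in> Hom (Cat G V) (ResO G U V i) (ResO G U V j)"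
  using assms by (intro cat_functor.arr[OF functor_res])

lemma ResM_comp:
  assumes "openin X U" "openin X V" "V \<subseteq> U" "f \<in> Hom (Cat G U) i j" "g \<in> Hom (Cat G U) j k"
  shows "ResM G U V (g \<cdot>\<^bsub>Cat G U\<^esub> f) = ResM G U V g \<cdot>\<^bsub>Cat G V\<^esub> ResM G U V f"
  using assms by (intro cat_functor.pres_comp[OF functor_res])

lemma ResM_HomSec:
  assumes "openin X U" "openin X V" "V \<subseteq> U" "f \<in> Hom (Cat G U) i j"
  shows "ResM G U V f \<in> HomSec G U i U j V"
  using ResM_Hom[OF assms] by (simp add: HomSec_def)

text \<open>By naturality of the unit arrows, \<open>ResM G U U\<close> is conjugation by
  isomorphisms. This lemma and the next one translate between arrows over \<open>U\<close> and
  sections over \<open>U\<close> of their Hom presheaf.\<close>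

lemma ResM_self_inj:
  assumes U: "openin X U" and f: "f \<in> Hom (Cat G U) i j" and g: "g \<in> Hom (Cat G U) i j"
    and eq: "ResM G U U f = ResM G U U g"
  shows "f = g"
proof -
  interpret groupoid "Cat G U" using groupoid[OF U] .
  have "i \<in> Obj (Cat G U)" using Hom_Obj f by blast
  from cancel_right[OF f g unit_iso[OF U this]] show ?thesis
    using unit_iso_natural[OF U f] unit_iso_natural[OF U g] eq by simp
qed

text \<open>The preimage is \<open>t\<close> conjugated back by the unit arrows of \<open>i\<close>
  and \<open>j\<close>.\<close>

lemma ResM_self_surj:
  assumes U: "openin X U" and i: "i \<in> Obj (Cat G U)" and j: "j \<in> Obj (Cat G U)"
    and t: "t \<in> HomSec G U i U j U"
  obtains f where "f \<in> Hom (Cat G U) i j" "ResM G U U f = t"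
proof -
  interpret groupoid "Cat G U" using groupoid[OF U] .
  note ui = unit_iso[OF U i] and uj = unit_iso[OF U j]
  have t: "t \<in> Hom (Cat G U) (ResO G U U i) (ResO G U U j)" using t by (simp add: HomSec_def)
  define f where "f = UnitIso G U j \<cdot>\<^bsub>Cat G U\<^esub> t \<cdot>\<^bsub>Cat G U\<^esub> arr_inv (Cat G U) (UnitIso G U i)"
  have f: "f \<in> Hom (Cat G U) i j"
    unfolding f_def by (rule comp[OF arr_inv_Hom[OF ui] comp[OF t uj]])
  have "UnitIso G U j \<cdot>\<^bsub>Cat G U\<^esub> ResM G U U f = UnitIso G U j \<cdot>\<^bsub>Cat G U\<^esub> t"
    unfolding unit_iso_natural[OF U f] unfolding f_def
    by (rule comp_arr_inv_cancel[OF comp[OF t uj] ui])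
  then have "ResM G U U f = t"
    by (rule cancel_left[OF ResM_Hom[OF U U subset_refl f] t uj])
  with f that show ?thesis by blast
qed

text \<open>Conjugation by coherence arrows is handled through the intertwining equations
  \<open>HomRes_intertwine\<close> and \<open>HomMap_intertwine\<close>, which determine the conjugates by cancellation.\<close>

context
  fixes U V W i j
  assumes U: "openin X U" and V: "openin X V" and W: "openin X W" and WV: "W \<subseteq> V" and VU: "V \<subseteq> U"
    and i: "i \<in> Obj (Cat G U)" and j: "j \<in> Obj (Cat G U)"
begin

interpretation GW: groupoid "Cat G W" using groupoid[OF W] .

lemma
  assumes f: "f \<in> HomSec G U i U j V"
  shows HomRes_HomSec: "HomRes G U i U j V W f \<in> HomSec G U i U j W"
    and HomRes_intertwine: "HomRes G U i U j V W f \<cdot>\<^bsub>Cat G W\<^esub> CompIso G U V W i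
      = CompIso G U V W j \<cdot>\<^bsub>Cat G W\<^esub> ResM G V W f"
proof -
  note ci = comp_iso[OF U V W WV VU i] and cj = comp_iso[OF U V W WV VU j]
  have f': "f \<in> Hom (Cat G V) (ResO G U V i) (ResO G U V j)" using f by (simp add: HomSec_def)
  note d = GW.comp[OF ResM_Hom[OF V W WV f'] cj]
  show "HomRes G U i U j V W f \<in> HomSec G U i U j W"
    unfolding HomRes_def HomSec_def by (rule GW.comp[OF GW.arr_inv_Hom[OF ci] d])
  show "HomRes G U i U j V W f \<cdot>\<^bsub>Cat G W\<^esub> CompIso G U V W i
      = CompIso G U V W j \<cdot>\<^bsub>Cat G W\<^esub> ResM G V W f"
    unfolding HomRes_def by (rule GW.comp_arr_inv_cancel[OF d ci])
qed

lemma HomRes_unique: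
  assumes f: "f \<in> HomSec G U i U j V" and g: "g \<in> HomSec G U i U j W"
    and "g \<cdot>\<^bsub>Cat G W\<^esub> CompIso G U V W i = CompIso G U V W j \<cdot>\<^bsub>Cat G W\<^esub> ResM G V W f"
  shows "HomRes G U i U j V W f = g"
  using GW.cancel_right[OF _ _ comp_iso[OF U V W WV VU i]] 
    HomRes_HomSec[OF f] HomRes_intertwine[OF f] g assms(3)
  unfolding HomSec_def by simp

text \<open>Naturality of \<open>CompIso\<close> is precisely the intertwining equation that
  characterizes \<open>HomRes\<close>.\<close>

lemma HomRes_ResM:
  assumes f: "f \<in> Hom (Cat G U) i j"
  shows "HomRes G U i U j V W (ResM G U V f) = ResM G U W f"
  using comp_iso_natural[OF U V W WV VU f] WV VU
  by (intro HomRes_unique ResM_HomSec[OF U _ _ f] V W) auto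

end

lemma HomSec_comp:
  assumes "openin X V" "f \<in> HomSec G U i U j V" "g \<in> HomSec G U j U k V"
  shows "g \<cdot>\<^bsub>Cat G V\<^esub> f \<in> HomSec G U i U k V"
proof -
  interpret groupoid "Cat G V" using groupoid[OF assms(1)] .
  show ?thesis using assms comp unfolding HomSec_def by blast
qed

text \<open>The intertwining squares of \<open>f\<close> and \<open>g\<close> share the side
  \<open>CompIso G U V W j\<close>; pasted together they form the square that determines the
  restriction of the composite.\<close>

lemma HomRes_comp:
  assumes U: "openin X U" and V: "openin X V" and W: "openin X W" and WV: "W \<subseteq> V" and VU: "V \<subseteq> U"
    and i: "i \<in> Obj (Cat G U)" and j: "j \<in> Obj (Cat G U)" and k: "k \<in> Obj (Cat G U)"
    and f: "f \<in> HomSec G U i U j V" and g: "g \<in> HomSec G U j U k V"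
  shows "HomRes G U i U k V W (g \<cdot>\<^bsub>Cat G V\<^esub> f) =
    HomRes G U j U k V W g \<cdot>\<^bsub>Cat G W\<^esub> HomRes G U i U j V W f"
proof (rule HomRes_unique[OF U V W WV VU i k HomSec_comp[OF V f g]])
  interpret groupoid "Cat G W" using groupoid[OF W] .
  note ci = comp_iso[OF U V W WV VU i] and cj = comp_iso[OF U V W WV VU j]
    and ck = comp_iso[OF U V W WV VU k]
  note rf = HomRes_HomSec[OF U V W WV VU i j f] and rg = HomRes_HomSec[OF U V W WV VU j k g]
  have f': "f \<in> Hom (Cat G V) (ResO G U V i) (ResO G U V j)"
    and g': "g \<in> Hom (Cat G V) (ResO G U V j) (ResO G U V k)" using f g by (simp_all add: HomSec_def)
  show "HomRes G U j U k V W g \<cdot>\<^bsub>Cat G W\<^esub> HomRes G U i U j V W f \<in> HomSec G U i U k W"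
    by (rule HomSec_comp[OF W rf rg])
  note rf = rf[unfolded HomSec_def] and rg = rg[unfolded HomSec_def]
  show "HomRes G U j U k V W g \<cdot>\<^bsub>Cat G W\<^esub> HomRes G U i U j V W f \<cdot>\<^bsub>Cat G W\<^esub> CompIso G U V W i =
    CompIso G U V W k \<cdot>\<^bsub>Cat G W\<^esub> ResM G V W (g \<cdot>\<^bsub>Cat G V\<^esub> f)"
    using comp_assoc[OF ci rf rg] comp_assoc[OF ResM_Hom[OF V W WV f'] cj rg]
      comp_assoc[OF ResM_Hom[OF V W WV f'] ResM_Hom[OF V W WV g'] ck]
      HomRes_intertwine[OF U V W WV VU i j f] HomRes_intertwine[OF U V W WV VU j k g]
      ResM_comp[OF V W WV f' g'] by simp
qed

end


section \<open>The maps on Hom sheaves induced by a morphism of gerbes\<close>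

context gerbe_morphism
begin

context
  fixes U V
  assumes U: "openin X U" and V: "openin X V" and VU: "V \<subseteq> U"
begin

interpretation HV: groupoid "Cat H V" using H.groupoid[OF V] .

lemma MorO_Obj: "i \<in> Obj (Cat G U) \<Longrightarrow> MorO F U i \<in> Obj (Cat H U)"
  by (rule cat_functor.obj[OF functor_mor[OF U]])

context
  fixes i j
  assumes i: "i \<in> Obj (Cat G U)" and j: "j \<in> Obj (Cat G U)"
begin

lemma
  assumes f: "f \<in> HomSec G U i U j V"
  shows HomMap_HomSec: "HomMap H F U i U j V f \<in> HomSec H U (MorO F U i) U (MorO F U j) V"
    and HomMap_intertwine: "HomMap H F U i U j V f \<cdot>\<^bsub>Cat H V\<^esub> MorIso F U V i
      = MorIso F U V j \<cdot>\<^bsub>Cat H V\<^esub> MorM F V f"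
proof -
  note ci = mor_iso[OF U V VU i] and cj = mor_iso[OF U V VU j]
  have f': "f \<in> Hom (Cat G V) (ResO G U V i) (ResO G U V j)" using f by (simp add: HomSec_def)
  note d = HV.comp[OF cat_functor.arr[OF functor_mor[OF V] f'] cj]
  show "HomMap H F U i U j V f \<in> HomSec H U (MorO F U i) U (MorO F U j) V"
    unfolding HomMap_def HomSec_def by (rule HV.comp[OF HV.arr_inv_Hom[OF ci] d])
  show "HomMap H F U i U j V f \<cdot>\<^bsub>Cat H V\<^esub> MorIso F U V i
      = MorIso F U V j \<cdot>\<^bsub>Cat H V\<^esub> MorM F V f"
    unfolding HomMap_def by (rule HV.comp_arr_inv_cancel[OF d ci])
qed

lemma HomMap_unique:
  assumes f: "f \<in> HomSec G U i U j V" and g: "g \<in> HomSec H U (MorO F U i) U (MorO F U j) V"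
    and "g \<cdot>\<^bsub>Cat H V\<^esub> MorIso F U V i = MorIso F U V j \<cdot>\<^bsub>Cat H V\<^esub> MorM F V f"
  shows "HomMap H F U i U j V f = g"
  using HV.cancel_right[OF _ _ mor_iso[OF U V VU i]] HomMap_HomSec[OF f] HomMap_intertwine[OF f]
    g assms(3)
  unfolding HomSec_def by simp

lemma HomMap_ResM:
  assumes f: "f \<in> Hom (Cat G U) i j"
  shows "HomMap H F U i U j V (ResM G U V f) = ResM H U V (MorM F U f)"
  using mor_iso_natural[OF U V VU f]
  by (intro HomMap_unique G.ResM_HomSec[OF U V VU f] H.ResM_HomSec[OF U V VU]
      cat_functor.arr[OF functor_mor[OF U] f]) auto

end

lemma HomMap_comp:
  assumes i: "i \<in> Obj (Cat G U)" and j: "j \<in> Obj (Cat G U)" and k: "k \<in> Obj (Cat G U)"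
    and f: "f \<in> HomSec G U i U j V" and g: "g \<in> HomSec G U j U k V"
  shows "HomMap H F U i U k V (g \<cdot>\<^bsub>Cat G V\<^esub> f) =
    HomMap H F U j U k V g \<cdot>\<^bsub>Cat H V\<^esub> HomMap H F U i U j V f"
proof (rule HomMap_unique[OF i k G.HomSec_comp[OF V f g]])
  note ci = mor_iso[OF U V VU i] and cj = mor_iso[OF U V VU j] and ck = mor_iso[OF U V VU k]
  note rf = HomMap_HomSec[OF i j f] and rg = HomMap_HomSec[OF j k g]
  have f': "f \<in> Hom (Cat G V) (ResO G U V i) (ResO G U V j)"
    and g': "g \<in> Hom (Cat G V) (ResO G U V j) (ResO G U V k)" using f g by (simp_all add: HomSec_def)
  note mf = cat_functor.arr[OF functor_mor[OF V] f'] and mg = cat_functor.arr[OF functor_mor[OF V] g']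
  show "HomMap H F U j U k V g \<cdot>\<^bsub>Cat H V\<^esub> HomMap H F U i U j V f
      \<in> HomSec H U (MorO F U i) U (MorO F U k) V"
    by (rule H.HomSec_comp[OF V rf rg])
  note rf = rf[unfolded HomSec_def] and rg = rg[unfolded HomSec_def]
  show "HomMap H F U j U k V g \<cdot>\<^bsub>Cat H V\<^esub> HomMap H F U i U j V f \<cdot>\<^bsub>Cat H V\<^esub> MorIso F U V i =
    MorIso F U V k \<cdot>\<^bsub>Cat H V\<^esub> MorM F V (g \<cdot>\<^bsub>Cat G V\<^esub> f)"
    using HV.comp_assoc[OF ci rf rg] HV.comp_assoc[OF mf cj rg] HV.comp_assoc[OF mf mg ck]
      HomMap_intertwine[OF i j f] HomMap_intertwine[OF j k g]
      cat_functor.pres_comp[OF functor_mor[OF V] f' g'] by simp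
qed

end

text \<open>The two sides, \<open>a\<close> and \<open>b\<close>, are compared after precomposition
  with one arrow \<open>?m i\<close>, which is then cancelled. The link between them is
  \<open>mor_iso_comp\<close>: it says that the two ways from \<open>F((i|V)|W)\<close> to
  \<open>F(i)|W\<close> agree.\<close>

lemma HomMap_HomRes:
  assumes U: "openin X U" and V: "openin X V" and W: "openin X W" and WV: "W \<subseteq> V" and VU: "V \<subseteq> U"
    and i: "i \<in> Obj (Cat G U)" and j: "j \<in> Obj (Cat G U)" and f: "f \<in> HomSec G U i U j V"
  shows "HomMap H F U i U j W (HomRes G U i U j V W f) =
    HomRes H U (MorO F U i) U (MorO F U j) V W (HomMap H F U i U j V f)"
proof -
  interpret HW: groupoid "Cat H W" using H.groupoid[OF W] .
  note Fi = MorO_Obj[OF U V VU i] and Fj = MorO_Obj[OF U V VU j]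
  have WU: "W \<subseteq> U" using WV VU by blast
  define f1 where "f1 = HomRes G U i U j V W f"
  define f2 where "f2 = HomMap H F U i U j V f"
  note f1 = G.HomRes_HomSec[OF U V W WV VU i j f, folded f1_def]
    and e1 = G.HomRes_intertwine[OF U V W WV VU i j f, folded f1_def]
  note f2 = HomMap_HomSec[OF U V VU i j f, folded f2_def]
    and e2 = HomMap_intertwine[OF U V VU i j f, folded f2_def]
  define a where "a = HomMap H F U i U j W f1"
  define b where "b = HomRes H U (MorO F U i) U (MorO F U j) V W f2"
  note a = HomMap_HomSec[OF U W WU i j f1, folded a_def]
    and ea = HomMap_intertwine[OF U W WU i j f1, folded a_def]
  note b = H.HomRes_HomSec[OF U V W WV VU Fi Fj f2, folded b_def]
    and eb = H.HomRes_intertwine[OF U V W WV VU Fi Fj f2, folded b_def]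
  note [unfolded HomSec_def] = f f1 f2 a b
  note f = this(1) and f1 = this(2) and f2 = this(3) and a = this(4) and b = this(5)
  note Vi = G.ResO_Obj[OF U V VU i] and Vj = G.ResO_Obj[OF U V VU j]
  note ci = G.comp_iso[OF U V W WV VU i] and cj = G.comp_iso[OF U V W WV VU j]
  note Mf = cat_functor.arr[OF functor_mor[OF V] f]
  note MW = cat_functor.arr[OF functor_mor[OF W]] and MWc = cat_functor.pres_comp[OF functor_mor[OF W]]
  note rf = G.ResM_Hom[OF V W WV f]
  \<comment> \<open>For \<open>k = i, j\<close>, \<open>mor_iso_comp\<close> equates
    \<open>?m k\<close> with the composite of \<open>?n k\<close>, \<open>?r k\<close> and
    \<open>?c k\<close>. The computation uses the first form to move \<open>a\<close> across, and
    the second to move \<open>b\<close>.\<close>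
  let ?m = "\<lambda>k. MorIso F U W k \<cdot>\<^bsub>Cat H W\<^esub> MorM F W (CompIso G U V W k)"
  let ?c = "\<lambda>k. CompIso H U V W (MorO F U k)"
  let ?r = "\<lambda>k. ResM H V W (MorIso F U V k)"
  let ?n = "\<lambda>k. MorIso F V W (ResO G U V k)"
  have m: "?m i \<in> Hom (Cat H W) (MorO F W (ResO G V W (ResO G U V i))) (ResO H U W (MorO F U i))"
    by (rule HW.comp[OF MW[OF ci] mor_iso[OF U W WU i]])
  note Hci = H.comp_iso[OF U V W WV VU Fi] and Hcj = H.comp_iso[OF U V W WV VU Fj]
  note ri = H.ResM_Hom[OF V W WV mor_iso[OF U V VU i]] and rj = H.ResM_Hom[OF V W WV mor_iso[OF U V VU j]]
  note ni = mor_iso[OF V W WV Vi] and nj = mor_iso[OF V W WV Vj]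
  have "a \<cdot>\<^bsub>Cat H W\<^esub> ?m i = (a \<cdot>\<^bsub>Cat H W\<^esub> MorIso F U W i) \<cdot>\<^bsub>Cat H W\<^esub> MorM F W (CompIso G U V W i)"
    using HW.comp_assoc[OF MW[OF ci] mor_iso[OF U W WU i] a] by simp
  also have "\<dots> = MorIso F U W j \<cdot>\<^bsub>Cat H W\<^esub> MorM F W (f1 \<cdot>\<^bsub>Cat G W\<^esub> CompIso G U V W i)"
    using HW.comp_assoc[OF MW[OF ci] MW[OF f1] mor_iso[OF U W WU j]] MWc[OF ci f1] ea by simp
  also have "\<dots> = ?m j \<cdot>\<^bsub>Cat H W\<^esub> MorM F W (ResM G V W f)"
    using HW.comp_assoc[OF MW[OF rf] MW[OF cj] mor_iso[OF U W WU j]] MWc[OF rf cj] e1 by simp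
  \<comment> \<open>Here the route changes: up to now restriction in \<open>G\<close> came before
    \<open>F\<close>, from now on \<open>F\<close> is applied over \<open>V\<close> or pushed there
    and restricted in \<open>H\<close>.\<close>
  also have "\<dots> = ?c j \<cdot>\<^bsub>Cat H W\<^esub> ?r j \<cdot>\<^bsub>Cat H W\<^esub> ?n j \<cdot>\<^bsub>Cat H W\<^esub> MorM F W (ResM G V W f)"
    using mor_iso_comp[OF U V W WV VU j] by simp
  also have "\<dots> = ?c j \<cdot>\<^bsub>Cat H W\<^esub> ?r j \<cdot>\<^bsub>Cat H W\<^esub> (?n j \<cdot>\<^bsub>Cat H W\<^esub> MorM F W (ResM G V W f))"
    by (rule HW.comp_assoc[OF MW[OF rf] nj HW.comp[OF rj Hcj]])
  also have "\<dots> = ?c j \<cdot>\<^bsub>Cat H W\<^esub> ?r j \<cdot>\<^bsub>Cat H W\<^esub> (ResM H V W (MorM F V f) \<cdot>\<^bsub>Cat H W\<^esub> ?n i)"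
    using mor_iso_natural[OF V W WV f] by simp
  also have "\<dots> = ?c j \<cdot>\<^bsub>Cat H W\<^esub> (?r j \<cdot>\<^bsub>Cat H W\<^esub> ResM H V W (MorM F V f)) \<cdot>\<^bsub>Cat H W\<^esub> ?n i"
    using HW.comp_assoc[OF ni H.ResM_Hom[OF V W WV Mf] HW.comp[OF rj Hcj]]
      HW.comp_assoc[OF H.ResM_Hom[OF V W WV Mf] rj Hcj] by simp
  also have "\<dots> = ?c j \<cdot>\<^bsub>Cat H W\<^esub> (ResM H V W f2 \<cdot>\<^bsub>Cat H W\<^esub> ?r i) \<cdot>\<^bsub>Cat H W\<^esub> ?n i"
    using e2 H.ResM_comp[OF V W WV Mf mor_iso[OF U V VU j]]
      H.ResM_comp[OF V W WV mor_iso[OF U V VU i] f2] by simp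
  also have "\<dots> = (b \<cdot>\<^bsub>Cat H W\<^esub> ?c i) \<cdot>\<^bsub>Cat H W\<^esub> ?r i \<cdot>\<^bsub>Cat H W\<^esub> ?n i"
    using HW.comp_assoc[OF ri H.ResM_Hom[OF V W WV f2] Hcj] eb by simp
  also have "\<dots> = b \<cdot>\<^bsub>Cat H W\<^esub> (?c i \<cdot>\<^bsub>Cat H W\<^esub> ?r i \<cdot>\<^bsub>Cat H W\<^esub> ?n i)"
    using HW.comp_assoc[OF ri Hci b] HW.comp_assoc[OF ni HW.comp[OF ri Hci] b] by simp
  also have "\<dots> = b \<cdot>\<^bsub>Cat H W\<^esub> ?m i"
    using mor_iso_comp[OF U V W WV VU i] by simp
  finally have "a = b" using HW.cancel_right[OF a b m] by blast
  then show ?thesis by (simp add: a_def b_def f1_def f2_def)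
qed

end


section \<open>Coboundaries and refinement\<close>

text \<open>The pairwise intersections are indexed by themselves, not by pairs of indices, so that
  the index type is again \<open>'x set\<close>, as \<open>cech_rel\<close> and \<open>glue\<close>
  demand.\<close>

lemma open_covering_refinement_Int:
  assumes "open_covering X T (K, U)" "open_covering X T (L, V)"
  obtains M :: "'x set set" and \<sigma> \<tau> where "open_covering X T (M, \<lambda>W. W)"
    "refinement (K, U) (M, \<lambda>W. W) \<sigma>" "refinement (L, V) (M, \<lambda>W. W) \<tau>"
proof -
  define M where "M = {U k \<inter> V l |k l. k \<in> K \<and> l \<in> L}"
  \<comment> \<open>One set may be an intersection in several ways; \<open>p\<close> picks one pair
    of indices for each member, and its components are the two refinement maps.\<close>
  have "\<forall>W\<in>M. \<exists>p. fst p \<in> K \<and> snd p \<in> L \<and> W = U (fst p) \<inter> V (snd p)"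
    by (force simp: M_def)
  then obtain p where p: "\<forall>W\<in>M. fst (p W) \<in> K \<and> snd (p W) \<in> L \<and> W = U (fst (p W)) \<inter> V (snd (p W))"
    by metis
  have "\<Union>M = (\<Union>k\<in>K. U k) \<inter> (\<Union>l\<in>L. V l)" by (auto simp: M_def)
  then have "open_covering X T (M, \<lambda>W. W)"
    using assms by (auto simp: open_covering_def M_def)
  moreover have "refinement (K, U) (M, \<lambda>W. W) (fst \<circ> p)" "refinement (L, V) (M, \<lambda>W. W) (snd \<circ> p)"
    using p by (auto simp: refinement_def)
  ultimately show ?thesis using that by blast
qed

lemma refinement_comp:
  "refinement (K, U) (L, V) \<sigma> \<Longrightarrow> refinement (L, V) (M, W) \<tau> \<Longrightarrow> refinement (K, U) (M, W) (\<sigma> \<circ> \<tau>)"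
  unfolding refinement_def by fastforce

lemma open_covering_trivial_cover: "open_covering X (topspace X) (trivial_cover X)"
  by (simp add: open_covering_def trivial_cover_def)

text \<open>\<open>cech_Z1\<close> changes only the carrier of \<open>cech_C1\<close>, and a coset
  depends only on the multiplication. Cosets can therefore be handled in the product group
  \<open>cech_C1\<close>.\<close>

lemma r_coset_cech_Z1: "A #>\<^bsub>cech_Z1 N \<U>\<^esub> c = A #>\<^bsub>cech_C1 N \<U>\<^esub> c"
  by (simp add: r_coset_def cech_Z1_def)

lemma cech_rel_sym: "(p, q) \<in> cech_rel X N \<Longrightarrow> (q, p) \<in> cech_rel X N"
  unfolding cech_rel_def by (clarsimp, metis)

section \<open>Cochains, coboundaries and the trivial class over one covering\<close>

context abelian_group_sheaf
begin

lemma Res_closed: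
  "openin X U \<Longrightarrow> openin X V \<Longrightarrow> V \<subseteq> U \<Longrightarrow> s \<in> carrier (Sec N U) \<Longrightarrow> Res N U V s \<in> carrier (Sec N V)"
  by (rule res)

lemma Res_group_hom:
  "openin X U \<Longrightarrow> openin X V \<Longrightarrow> V \<subseteq> U \<Longrightarrow> group_hom (Sec N U) (Sec N V) (Res N U V)"
  using res_hom sec_group by (simp add: group_hom_def group_hom_axioms_def comm_group_def)

context
  fixes K U
  assumes open_U: "\<forall>k\<in>K. openin X (U k)"
begin

lemma group_cech_C0: "group (cech_C0 N (K, U))"
  unfolding cech_C0_def prod.case
  using open_U sec_group by (auto intro!: product_group simp: comm_group_def)

lemma group_cech_C1: "group (cech_C1 N (K, U))"
  unfolding cech_C1_def prod.case
  using open_U sec_group by (intro product_group) (auto simp: comm_group_def openin_Int)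

lemma cech_d0_closed:
  assumes "b \<in> carrier (cech_C0 N (K, U))"
  shows "cech_d0 N (K, U) b \<in> carrier (cech_C1 N (K, U))"
proof -
  have "Res N (U l) (U k \<inter> U l) (b l) \<otimes>\<^bsub>Sec N (U k \<inter> U l)\<^esub>
      inv\<^bsub>Sec N (U k \<inter> U l)\<^esub> Res N (U k) (U k \<inter> U l) (b k) \<in> carrier (Sec N (U k \<inter> U l))"
    if k: "k \<in> K" and l: "l \<in> K" for k l
  proof -
    have W: "openin X (U k \<inter> U l)" using open_U k l by blast
    interpret comm_group "Sec N (U k \<inter> U l)" using sec_group[OF W] .
    have "b k \<in> carrier (Sec N (U k))" "b l \<in> carrier (Sec N (U l))"
      using assms k l by (auto simp: cech_C0_def)
    then show ?thesis using open_U k l W by (auto intro!: m_closed inv_closed Res_closed)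
  qed
  then show ?thesis by (auto simp: cech_C1_def cech_d0_def Let_def)
qed

text \<open>Regrouping the factors uses commutativity of the groups of sections. The consequence of
  interest is that \<open>cech_B1\<close>, as an image, is a subgroup.\<close>

lemma cech_d0_hom: "cech_d0 N (K, U) \<in> hom (cech_C0 N (K, U)) (cech_C1 N (K, U))"
proof (rule homI)
  fix b b' assume b: "b \<in> carrier (cech_C0 N (K, U))" "b' \<in> carrier (cech_C0 N (K, U))"
  have "Res N (U l) W (b l \<otimes>\<^bsub>Sec N (U l)\<^esub> b' l) \<otimes>\<^bsub>Sec N W\<^esub>
      inv\<^bsub>Sec N W\<^esub> Res N (U k) W (b k \<otimes>\<^bsub>Sec N (U k)\<^esub> b' k) =
      (Res N (U l) W (b l) \<otimes>\<^bsub>Sec N W\<^esub> inv\<^bsub>Sec N W\<^esub> Res N (U k) W (b k)) \<otimes>\<^bsub>Sec N W\<^esub>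
      (Res N (U l) W (b' l) \<otimes>\<^bsub>Sec N W\<^esub> inv\<^bsub>Sec N W\<^esub> Res N (U k) W (b' k))"
    if k: "k \<in> K" and l: "l \<in> K" and W_def: "W = U k \<inter> U l" for k l W
  proof -
    have W: "openin X W" "W \<subseteq> U k" "W \<subseteq> U l" using open_U k l unfolding W_def by auto
    interpret comm_group "Sec N W" using sec_group[OF W(1)] .
    interpret hk: group_hom "Sec N (U k)" "Sec N W" "Res N (U k) W"
      using Res_group_hom W open_U k by blast
    interpret hl: group_hom "Sec N (U l)" "Sec N W" "Res N (U l) W"
      using Res_group_hom W open_U l by blast
    have "b k \<in> carrier (Sec N (U k))" "b l \<in> carrier (Sec N (U l))"
      "b' k \<in> carrier (Sec N (U k))" "b' l \<in> carrier (Sec N (U l))"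
      using b k l by (auto simp: cech_C0_def)
    then show ?thesis by (simp add: inv_mult m_ac)
  qed
  then show "cech_d0 N (K, U) (b \<otimes>\<^bsub>cech_C0 N (K, U)\<^esub> b') =
      cech_d0 N (K, U) b \<otimes>\<^bsub>cech_C1 N (K, U)\<^esub> cech_d0 N (K, U) b'"
    by (auto simp: cech_d0_def cech_C0_def cech_C1_def Let_def fun_eq_iff)
qed (rule cech_d0_closed)

lemma subgroup_cech_B1: "subgroup (cech_B1 N (K, U)) (cech_C1 N (K, U))"
proof -
  interpret group_hom "cech_C0 N (K, U)" "cech_C1 N (K, U)" "cech_d0 N (K, U)"
    using group_cech_C0 group_cech_C1 cech_d0_hom by (simp add: group_hom_def group_hom_axioms_def)
  show ?thesis unfolding cech_B1_def by (rule img_is_subgroup)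
qed

lemma mem_r_coset_cech_B1:
  assumes "c \<in> carrier (cech_C1 N (K, U))"
  shows "c \<in> cech_B1 N (K, U) #>\<^bsub>cech_Z1 N (K, U)\<^esub> c"
  unfolding r_coset_cech_Z1 by (rule group.rcos_self[OF group_cech_C1 assms subgroup_cech_B1])

lemma r_coset_cech_B1_eq:
  "c \<in> cech_B1 N (K, U) \<Longrightarrow> cech_B1 N (K, U) #>\<^bsub>cech_Z1 N (K, U)\<^esub> c = cech_B1 N (K, U)"
  unfolding r_coset_cech_Z1 by (rule subgroup.rcos_const[OF subgroup_cech_B1 group_cech_C1])

lemma one_cech_Z1: "\<one>\<^bsub>cech_C1 N (K, U)\<^esub> \<in> carrier (cech_Z1 N (K, U))"
proof -
  have "Res N (U l \<inter> U m) W \<one>\<^bsub>Sec N (U l \<inter> U m)\<^esub> \<otimes>\<^bsub>Sec N W\<^esub>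
      inv\<^bsub>Sec N W\<^esub> Res N (U k \<inter> U m) W \<one>\<^bsub>Sec N (U k \<inter> U m)\<^esub> \<otimes>\<^bsub>Sec N W\<^esub>
      Res N (U k \<inter> U l) W \<one>\<^bsub>Sec N (U k \<inter> U l)\<^esub> = \<one>\<^bsub>Sec N W\<^esub>"
    if "k \<in> K" "l \<in> K" "m \<in> K" and W_def: "W = U k \<inter> U l \<inter> U m" for k l m W
  proof -
    have W: "openin X W" "W \<subseteq> U k \<inter> U l" "W \<subseteq> U k \<inter> U m" "W \<subseteq> U l \<inter> U m"
      and op: "openin X (U k \<inter> U l)" "openin X (U k \<inter> U m)" "openin X (U l \<inter> U m)"
      using open_U that by auto
    interpret comm_group "Sec N W" using sec_group[OF W(1)] .
    show ?thesis
      using group_hom.hom_one[OF Res_group_hom] W op by simp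
  qed
  then show ?thesis
    using monoid.one_closed[OF group.is_monoid[OF group_cech_C1]]
    by (auto simp: cech_Z1_def kernel_def cech_C1_def cech_C2_def cech_d1_def Let_def fun_eq_iff)
qed

text \<open>\<open>cech_B1\<close> is the coset of the unit cochain, which is a cocycle; it is the
  unit of \<open>cover_H1\<close>.\<close>

lemma cech_B1_in_cover_H1: "cech_B1 N (K, U) \<in> carrier (cover_H1 N (K, U))"
proof -
  have "\<one>\<^bsub>cech_C1 N (K, U)\<^esub> \<in> cech_B1 N (K, U)"
    by (rule subgroup.one_closed[OF subgroup_cech_B1])
  from r_coset_cech_B1_eq[OF this] one_cech_Z1 show ?thesis
    unfolding cover_H1_def FactGroup_def RCOSETS_def by auto
qed

lemma cover_H1_subset:
  assumes "a \<in> carrier (cover_H1 N (K, U))"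
  shows "a \<noteq> {}" "a \<subseteq> carrier (cech_C1 N (K, U))"
proof -
  obtain c where c: "c \<in> carrier (cech_C1 N (K, U))" and a: "a = cech_B1 N (K, U) #>\<^bsub>cech_Z1 N (K, U)\<^esub> c"
    using assms by (auto simp: cover_H1_def FactGroup_def RCOSETS_def cech_Z1_def kernel_def)
  show "a \<noteq> {}" using mem_r_coset_cech_B1[OF c] a by auto
  show "a \<subseteq> carrier (cech_C1 N (K, U))"
    unfolding a r_coset_cech_Z1
    by (rule monoid.r_coset_subset_G[OF group.is_monoid[OF group_cech_C1]
          subgroup.subset[OF subgroup_cech_B1] c])
qed

end

section \<open>Behaviour of cochains and classes under refinement\<close>

context
  fixes K U L V \<tau>
  assumes open_U: "\<forall>k\<in>K. openin X (U k)"
    and open_V: "\<forall>l\<in>L. openin X (V l)" and \<tau>: "refinement (K, U) (L, V) \<tau>"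
begin

lemma refine_cochain_closed:
  assumes "c \<in> carrier (cech_C1 N (K, U))"
  shows "refine_cochain N (K, U) (L, V) \<tau> c \<in> carrier (cech_C1 N (L, V))"
proof -
  have "Res N (U (\<tau> l) \<inter> U (\<tau> m)) (V l \<inter> V m) (c (\<tau> l, \<tau> m)) \<in> carrier (Sec N (V l \<inter> V m))"
    if "l \<in> L" "m \<in> L" for l m
    using that \<tau> open_U open_V assms
    by (intro Res_closed) (force simp: refinement_def cech_C1_def)+
  then show ?thesis by (auto simp: refine_cochain_def cech_C1_def)
qed

lemma refine_cochain_cech_B1:
  assumes "c \<in> cech_B1 N (K, U)"
  shows "refine_cochain N (K, U) (L, V) \<tau> c \<in> cech_B1 N (L, V)"
proof -
  obtain b where b: "b \<in> carrier (cech_C0 N (K, U))" and c: "c = cech_d0 N (K, U) b"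
    using assms by (auto simp: cech_B1_def)
  \<comment> \<open>The 0-cochain pulled back along \<open>\<tau>\<close>; by transitivity of
    restriction its coboundary is the refinement of \<open>c\<close>.\<close>
  define b' where "b' = (\<lambda>l\<in>L. Res N (U (\<tau> l)) (V l) (b (\<tau> l)))"
  have "b' \<in> carrier (cech_C0 N (L, V))"
    using \<tau> open_U open_V b by (fastforce simp: b'_def cech_C0_def refinement_def intro!: Res_closed)
  moreover have "Res N W' W (Res N (U (\<tau> m)) W' (b (\<tau> m)) \<otimes>\<^bsub>Sec N W'\<^esub>
      inv\<^bsub>Sec N W'\<^esub> Res N (U (\<tau> l)) W' (b (\<tau> l))) =
      Res N (V m) W (b' m) \<otimes>\<^bsub>Sec N W\<^esub> inv\<^bsub>Sec N W\<^esub> Res N (V l) W (b' l)"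
    if lm: "l \<in> L" "m \<in> L" and W_def: "W = V l \<inter> V m" and W'_def: "W' = U (\<tau> l) \<inter> U (\<tau> m)" for l m W W'
  proof -
    have k: "\<tau> l \<in> K" "\<tau> m \<in> K" and VU: "V l \<subseteq> U (\<tau> l)" "V m \<subseteq> U (\<tau> m)"
      using lm \<tau> by (auto simp: refinement_def)
    have op: "openin X W" "openin X W'" "openin X (V l)" "openin X (V m)"
      "openin X (U (\<tau> l))" "openin X (U (\<tau> m))"
      using open_U open_V lm k by (auto simp: W_def W'_def)
    have sub: "W \<subseteq> W'" "W \<subseteq> V l" "W \<subseteq> V m" "W' \<subseteq> U (\<tau> l)" "W' \<subseteq> U (\<tau> m)"
      using VU by (auto simp: W_def W'_def)
    interpret group_hom "Sec N W'" "Sec N W" "Res N W' W"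
      using Res_group_hom op sub by blast
    have b: "b (\<tau> l) \<in> carrier (Sec N (U (\<tau> l)))" "b (\<tau> m) \<in> carrier (Sec N (U (\<tau> m)))"
      using b k by (auto simp: cech_C0_def)
    have "Res N (U (\<tau> l)) W' (b (\<tau> l)) \<in> carrier (Sec N W')"
      "Res N (U (\<tau> m)) W' (b (\<tau> m)) \<in> carrier (Sec N W')"
      using b op sub Res_closed by blast+
    then show ?thesis
      using b op sub VU lm by (simp add: b'_def res_res)
  qed
  then have "refine_cochain N (K, U) (L, V) \<tau> c = cech_d0 N (L, V) b'"
    using \<tau> unfolding c
    by (auto simp: refine_cochain_def cech_d0_def Let_def refinement_def fun_eq_iff Pi_iff)
  ultimately show ?thesis by (auto simp: cech_B1_def)
qed

lemma refine_cochain_comp: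
  assumes c: "c \<in> carrier (cech_C1 N (K, U))" and open_W: "\<forall>m\<in>M. openin X (W m)"
    and \<sigma>: "refinement (L, V) (M, W) \<sigma>"
  shows "refine_cochain N (L, V) (M, W) \<sigma> (refine_cochain N (K, U) (L, V) \<tau> c) =
    refine_cochain N (K, U) (M, W) (\<tau> \<circ> \<sigma>) c"
proof -
  have "Res N (V (\<sigma> m) \<inter> V (\<sigma> n)) (W m \<inter> W n)
        (Res N (U (\<tau> (\<sigma> m)) \<inter> U (\<tau> (\<sigma> n))) (V (\<sigma> m) \<inter> V (\<sigma> n)) (c (\<tau> (\<sigma> m), \<tau> (\<sigma> n)))) =
      Res N (U (\<tau> (\<sigma> m)) \<inter> U (\<tau> (\<sigma> n))) (W m \<inter> W n) (c (\<tau> (\<sigma> m), \<tau> (\<sigma> n)))"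
    if mn: "m \<in> M" "n \<in> M" for m n
  proof -
    have l: "\<sigma> m \<in> L" "\<sigma> n \<in> L" and WV: "W m \<subseteq> V (\<sigma> m)" "W n \<subseteq> V (\<sigma> n)"
      using mn \<sigma> by (auto simp: refinement_def)
    then have k: "\<tau> (\<sigma> m) \<in> K" "\<tau> (\<sigma> n) \<in> K"
      and VU: "V (\<sigma> m) \<subseteq> U (\<tau> (\<sigma> m))" "V (\<sigma> n) \<subseteq> U (\<tau> (\<sigma> n))"
      using \<tau> by (auto simp: refinement_def)
    show ?thesis
      using c open_U open_V open_W l k mn WV VU by (intro res_res) (auto simp: cech_C1_def PiE_iff)
  qed
  then show ?thesis
    using \<sigma> by (auto simp: refine_cochain_def refinement_def fun_eq_iff Pi_iff)
qed

text \<open>Every refined cochain lies in its own coset, and the coset of a coboundary is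
  \<open>cech_B1\<close>. Nonemptiness of \<open>a\<close> matters for the converse, since
  \<open>refine_H1\<close> is a union over \<open>a\<close>. Triviality of a refined class thereby
  becomes a condition on cochains.\<close>

lemma refine_H1_eq_cech_B1_iff:
  assumes "a \<noteq> {}" "a \<subseteq> carrier (cech_C1 N (K, U))"
  shows "refine_H1 N (K, U) (L, V) \<tau> a = cech_B1 N (L, V) \<longleftrightarrow>
    (\<forall>c\<in>a. refine_cochain N (K, U) (L, V) \<tau> c \<in> cech_B1 N (L, V))"
proof
  assume eq: "refine_H1 N (K, U) (L, V) \<tau> a = cech_B1 N (L, V)"
  show "\<forall>c\<in>a. refine_cochain N (K, U) (L, V) \<tau> c \<in> cech_B1 N (L, V)"
  proof
    fix c assume "c \<in> a"
    then have "refine_cochain N (K, U) (L, V) \<tau> c \<in> refine_H1 N (K, U) (L, V) \<tau> a"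
      unfolding refine_H1_def
      using assms(2) mem_r_coset_cech_B1[OF open_V refine_cochain_closed] by blast
    then show "refine_cochain N (K, U) (L, V) \<tau> c \<in> cech_B1 N (L, V)" using eq by simp
  qed
next
  assume "\<forall>c\<in>a. refine_cochain N (K, U) (L, V) \<tau> c \<in> cech_B1 N (L, V)"
  then show "refine_H1 N (K, U) (L, V) \<tau> a = cech_B1 N (L, V)"
    using assms(1) r_coset_cech_B1_eq[OF open_V] by (simp add: refine_H1_def)
qed

lemma refine_H1_cech_B1:
  "refine_H1 N (K, U) (L, V) \<tau> (cech_B1 N (K, U)) = cech_B1 N (L, V)"
  using refine_H1_eq_cech_B1_iff[of "cech_B1 N (K, U)"] refine_cochain_cech_B1
    subgroup.one_closed[OF subgroup_cech_B1[OF open_U]] subgroup.subset[OF subgroup_cech_B1[OF open_U]]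
  by blast

end

text \<open>The right-hand side does not mention \<open>\<U>\<close>. Trivial pairs over all
  coverings therefore have one and the same class, and the unit of \<open>cech_H1\<close>, which
  lives over \<open>trivial_cover X\<close>, can be compared with classes over any covering.\<close>

lemma cech_class_cech_B1:
  fixes \<U> :: "('x set, 'x) cover"
  assumes \<U>: "open_covering X (topspace X) \<U>"
  shows "cech_class X N (\<U>, cech_B1 N \<U>) = {(\<V>, b) \<in> cech_reps X N.
    \<exists>(\<W> :: ('x set, 'x) cover) \<tau>. open_covering X (topspace X) \<W> \<and> refinement \<V> \<W> \<tau> \<and>
      (\<forall>c\<in>b. refine_cochain N \<V> \<W> \<tau> c \<in> cech_B1 N \<W>)}"
  (is "_ = ?R")
proof (rule Set.set_eqI, rule iffI)
  obtain K U where KU: "\<U> = (K, U)" by fastforce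
  have open_U: "\<forall>k\<in>K. openin X (U k)" using \<U> by (simp add: KU open_covering_def)
  have rep: "(\<U>, cech_B1 N \<U>) \<in> cech_reps X N"
    using \<U> cech_B1_in_cover_H1[OF open_U] by (simp add: cech_reps_def KU)
  fix p :: "('x, 'n) cech_rep"
  obtain L V b where p: "p = ((L, V), b)" by (metis surj_pair)
  have pD: "\<forall>l\<in>L. openin X (V l)" "b \<noteq> {}" "b \<subseteq> carrier (cech_C1 N (L, V))"
    "open_covering X (topspace X) (L, V)"
    if "p \<in> cech_reps X N"
  proof -
    show V: "\<forall>l\<in>L. openin X (V l)" and "open_covering X (topspace X) (L, V)"
      using that by (simp_all add: p cech_reps_def open_covering_def)
    show "b \<noteq> {}" "b \<subseteq> carrier (cech_C1 N (L, V))"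
      using cover_H1_subset[OF V] that by (auto simp: p cech_reps_def)
  qed
  {
    assume "p \<in> cech_class X N (\<U>, cech_B1 N \<U>)"
    then obtain M W \<sigma> \<tau> where pr: "p \<in> cech_reps X N"
      and W: "open_covering X (topspace X) (M :: 'x set set, W)"
      and \<sigma>: "refinement (K, U) (M, W) \<sigma>" and \<tau>: "refinement (L, V) (M, W) \<tau>"
      and eq: "refine_H1 N (K, U) (M, W) \<sigma> (cech_B1 N (K, U)) = refine_H1 N (L, V) (M, W) \<tau> b"
      by (auto simp: cech_class_def cech_rel_def p KU)
    have open_W: "\<forall>m\<in>M. openin X (W m)" using W by (simp add: open_covering_def)
    have "\<forall>c\<in>b. refine_cochain N (L, V) (M, W) \<tau> c \<in> cech_B1 N (M, W)"
      using refine_H1_eq_cech_B1_iff[OF pD(1)[OF pr] open_W \<tau> pD(2,3)[OF pr]] eq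
        refine_H1_cech_B1[OF open_U open_W \<sigma>] by simp
    then show "p \<in> ?R" using pr W \<tau> unfolding p by blast
  }
  assume "p \<in> ?R"
  then obtain M W \<tau> where pr: "p \<in> cech_reps X N"
    and W: "open_covering X (topspace X) (M :: 'x set set, W)" and \<tau>: "refinement (L, V) (M, W) \<tau>"
    and b: "\<forall>c\<in>b. refine_cochain N (L, V) (M, W) \<tau> c \<in> cech_B1 N (M, W)"
    unfolding p by auto
  have open_W: "\<forall>m\<in>M. openin X (W m)" using W by (simp add: open_covering_def)
  \<comment> \<open>\<open>(M, W)\<close> refines the covering of \<open>p\<close> but need not
    refine \<open>\<U>\<close>. Intersecting it with \<open>\<U>\<close> gives a common refinement,
    and coboundaries stay coboundaries there.\<close>
  obtain M' :: "'x set set" and \<pi> \<rho> where W': "open_covering X (topspace X) (M', \<lambda>W. W)"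
    and \<pi>: "refinement (K, U) (M', \<lambda>W. W) \<pi>" and \<rho>: "refinement (M, W) (M', \<lambda>W. W) \<rho>"
    using open_covering_refinement_Int[OF \<U>[unfolded KU] W] by metis
  have open_W': "\<forall>m\<in>M'. openin X m" using W' by (simp add: open_covering_def)
  note \<tau>\<rho> = refinement_comp[OF \<tau> \<rho>]
  have "refine_cochain N (L, V) (M', \<lambda>W. W) (\<tau> \<circ> \<rho>) c \<in> cech_B1 N (M', \<lambda>W. W)" if c: "c \<in> b" for c
  proof -
    have "c \<in> carrier (cech_C1 N (L, V))" using pD(3)[OF pr] c by blast
    note eq = refine_cochain_comp[OF pD(1)[OF pr] open_W \<tau> this open_W' \<rho>]
    show ?thesis
      unfolding eq[symmetric] by (rule refine_cochain_cech_B1[OF open_W open_W' \<rho> bspec[OF b c]])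
  qed
  then have "refine_H1 N (L, V) (M', \<lambda>W. W) (\<tau> \<circ> \<rho>) b = cech_B1 N (M', \<lambda>W. W)"
    using refine_H1_eq_cech_B1_iff[OF pD(1)[OF pr] open_W' \<tau>\<rho> pD(2,3)[OF pr]] by simp
  then have "((\<U>, cech_B1 N \<U>), p) \<in> cech_rel X N"
    using rep pr W' \<pi> \<tau>\<rho> refine_H1_cech_B1[OF open_U open_W' \<pi>]
    unfolding p KU cech_rel_def mem_Collect_eq prod.case by metis
  then show "p \<in> cech_class X N (\<U>, cech_B1 N \<U>)" by (simp add: cech_class_def)
qed

lemma one_cech_H1: "\<one>\<^bsub>cech_H1 X N\<^esub> = cech_class X N (trivial_cover X, cech_B1 N (trivial_cover X))"
  by (simp add: cech_H1_def cover_H1_def FactGroup_def)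

text \<open>The coset of a coboundary is \<open>cech_B1\<close> itself, so both sides are classes of
  trivial pairs and have the same explicit description.\<close>

lemma cech_class_coboundary:
  fixes \<U> :: "('x set, 'x) cover"
  assumes \<U>: "open_covering X (topspace X) \<U>" and c: "c \<in> cech_B1 N \<U>"
  shows "cech_class X N (\<U>, cech_B1 N \<U> #>\<^bsub>cech_Z1 N \<U>\<^esub> c) = \<one>\<^bsub>cech_H1 X N\<^esub>"
proof -
  obtain K U where KU: "\<U> = (K, U)" by fastforce
  have "\<forall>k\<in>K. openin X (U k)" using \<U> by (simp add: KU open_covering_def)
  from r_coset_cech_B1_eq[OF this] c show ?thesis
    unfolding one_cech_H1 cech_class_cech_B1[OF open_covering_trivial_cover]
    by (simp add: KU cech_class_cech_B1[OF \<U>, unfolded KU])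
qed

text \<open>The trivial pair lies in its own class, hence by \<open>one\<close> in the class of the
  given pair. Symmetry of \<open>cech_rel\<close> puts the given pair into the trivial class, whose
  description supplies the refinement; it is then applied to \<open>c\<close>, a member of its own
  coset.\<close>

lemma cech_class_eq_one_imp:
  fixes \<U> :: "('x set, 'x) cover"
  assumes \<U>: "open_covering X (topspace X) \<U>" and c: "c \<in> carrier (cech_C1 N \<U>)"
    and one: "cech_class X N (\<U>, cech_B1 N \<U> #>\<^bsub>cech_Z1 N \<U>\<^esub> c) = \<one>\<^bsub>cech_H1 X N\<^esub>"
  obtains L :: "'x set set" and V \<tau> where "open_covering X (topspace X) (L, V)"
    "refinement \<U> (L, V) \<tau>" "refine_cochain N \<U> (L, V) \<tau> c \<in> cech_B1 N (L, V)"
proof -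
  obtain K U where KU: "\<U> = (K, U)" by fastforce
  have open_U: "\<forall>k\<in>K. openin X (U k)" using \<U> by (simp add: KU open_covering_def)
  let ?T = "trivial_cover X" and ?a = "cech_B1 N \<U> #>\<^bsub>cech_Z1 N \<U>\<^esub> c"
  have "(?T, cech_B1 N ?T) \<in> cech_class X N (?T, cech_B1 N ?T)"
  proof -
    have "(?T, cech_B1 N ?T) \<in> cech_reps X N"
      using open_covering_trivial_cover[of X] cech_B1_in_cover_H1[of "{topspace X}" "\<lambda>U. U"]
      by (simp add: cech_reps_def trivial_cover_def)
    moreover have "refinement ?T ?T (\<lambda>U. U)" by (simp add: refinement_def trivial_cover_def)
    moreover have "\<forall>c\<in>cech_B1 N ?T. refine_cochain N ?T ?T (\<lambda>U. U) c \<in> cech_B1 N ?T"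
      unfolding trivial_cover_def
      by (intro ballI refine_cochain_cech_B1) (auto simp: refinement_def)
    ultimately show ?thesis
      unfolding cech_class_cech_B1[OF open_covering_trivial_cover]
      using open_covering_trivial_cover by blast
  qed
  then have "((\<U>, ?a), (?T, cech_B1 N ?T)) \<in> cech_rel X N"
    using one unfolding one_cech_H1 cech_class_def by blast
  from cech_rel_sym[OF this] have "(\<U>, ?a) \<in> cech_class X N (?T, cech_B1 N ?T)"
    by (simp add: cech_class_def)
  then obtain \<W> :: "('x set, 'x) cover" and \<tau> where "open_covering X (topspace X) \<W>"
    "refinement \<U> \<W> \<tau>" "\<forall>c\<in>?a. refine_cochain N \<U> \<W> \<tau> c \<in> cech_B1 N \<W>"
    by (auto simp: cech_class_cech_B1[OF open_covering_trivial_cover])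
  moreover have "c \<in> ?a" using mem_r_coset_cech_B1[OF open_U] c by (simp add: KU)
  ultimately show ?thesis using that by (metis surj_pair)
qed

end


section \<open>Lifts along a central extension\<close>

context central_extension
begin

context
  fixes U V i
  assumes U: "openin X U" and V: "openin X V" and VU: "V \<subseteq> U" and i: "i \<in> Obj (Cat G U)"
begin

interpretation GV: groupoid "Cat G V" using G.groupoid[OF V] .
interpretation HV: groupoid "Cat H V" using H.groupoid[OF V] .

lemma chi_HomSec: "n \<in> carrier (Sec N V) \<Longrightarrow> \<chi> U i V n \<in> HomSec G U i U i V"
  and HomMap_chi: "n \<in> carrier (Sec N V)
    \<Longrightarrow> HomMap H F U i U i V (\<chi> U i V n) = Ident (Cat H V) (ResO H U V (MorO F U i))"
  using chi_iso[OF U i V VU] by (auto simp: iso_def hom_def Pi_iff Ker_def kernel_def Aut_def)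

lemma chi_mult:
  "m \<in> carrier (Sec N V) \<Longrightarrow> n \<in> carrier (Sec N V)
    \<Longrightarrow> \<chi> U i V (m \<otimes>\<^bsub>Sec N V\<^esub> n) = \<chi> U i V m \<cdot>\<^bsub>Cat G V\<^esub> \<chi> U i V n"
  using chi_iso[OF U i V VU] by (auto simp: iso_def hom_def Aut_def)

lemma inj_on_chi: "inj_on (\<chi> U i V) (carrier (Sec N V))"
  using chi_iso[OF U i V VU] by (simp add: iso_def bij_betw_def)

lemma chi_image:
  "\<chi> U i V ` carrier (Sec N V) = {f \<in> HomSec G U i U i V.
    HomMap H F U i U i V f = Ident (Cat H V) (ResO H U V (MorO F U i))}"
  using chi_iso[OF U i V VU] by (simp add: iso_def bij_betw_def Ker_def kernel_def Aut_def)

section \<open>Right action of \<open>Sec N V\<close> on sections of the Hom sheaf by composition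
  with \<open>\<chi>\<close>\<close>

context
  fixes j
  assumes j: "j \<in> Obj (Cat G U)"
begin

lemma comp_chi_HomSec:
  "g \<in> HomSec G U i U j V \<Longrightarrow> n \<in> carrier (Sec N V) \<Longrightarrow> g \<cdot>\<^bsub>Cat G V\<^esub> \<chi> U i V n \<in> HomSec G U i U j V"
  using G.HomSec_comp[OF V chi_HomSec] .

lemma HomMap_comp_chi:
  assumes g: "g \<in> HomSec G U i U j V" and n: "n \<in> carrier (Sec N V)"
  shows "HomMap H F U i U j V (g \<cdot>\<^bsub>Cat G V\<^esub> \<chi> U i V n) = HomMap H F U i U j V g"
  using HomMap_comp[OF U V VU i i j chi_HomSec[OF n] g] HomMap_chi[OF n]
    HV.ident_right HomMap_HomSec[OF U V VU i j g] by (simp add: HomSec_def)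

text \<open>The action is free: \<open>g\<close> can be cancelled and \<open>\<chi>\<close> is
  injective.\<close>

lemma comp_chi_inj:
  assumes g: "g \<in> HomSec G U i U j V" and m: "m \<in> carrier (Sec N V)" and n: "n \<in> carrier (Sec N V)"
    and "g \<cdot>\<^bsub>Cat G V\<^esub> \<chi> U i V m = g \<cdot>\<^bsub>Cat G V\<^esub> \<chi> U i V n"
  shows "m = n"
  using assms GV.cancel_left chi_HomSec[OF m] chi_HomSec[OF n] inj_onD[OF inj_on_chi]
  unfolding HomSec_def by metis

lemma comp_chi_mult:
  assumes g: "g \<in> HomSec G U i U j V" and m: "m \<in> carrier (Sec N V)" and n: "n \<in> carrier (Sec N V)"
  shows "g \<cdot>\<^bsub>Cat G V\<^esub> \<chi> U i V m \<cdot>\<^bsub>Cat G V\<^esub> \<chi> U i V n = g \<cdot>\<^bsub>Cat G V\<^esub> \<chi> U i V (m \<otimes>\<^bsub>Sec N V\<^esub> n)"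
  using GV.comp_assoc chi_HomSec[OF m] chi_HomSec[OF n] g chi_mult[OF m n]
  unfolding HomSec_def by metis

text \<open>The action is transitive on sections with equal image: the image of
  \<open>arr_inv g \<cdot> g'\<close> becomes the identity after cancelling the image of
  \<open>g\<close>, so this arrow lies in the range of \<open>\<chi>\<close>. The formula for
  \<open>n\<close> has the shape of the entries of \<open>lift_cochain\<close>, so both facts apply
  to them directly.\<close>

lemma
  assumes g: "g \<in> HomSec G U i U j V" and g': "g' \<in> HomSec G U i U j V"
    and eq: "HomMap H F U i U j V g = HomMap H F U i U j V g'"
  defines "n \<equiv> inv_into (carrier (Sec N V)) (\<chi> U i V) (arr_inv (Cat G V) g \<cdot>\<^bsub>Cat G V\<^esub> g')"
  shows difference_closed: "n \<in> carrier (Sec N V)"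
    and comp_chi_difference: "g \<cdot>\<^bsub>Cat G V\<^esub> \<chi> U i V n = g'"
proof -
  let ?k = "arr_inv (Cat G V) g \<cdot>\<^bsub>Cat G V\<^esub> g'" and ?F = "HomMap H F U i U j V"
    and ?E = "HomMap H F U i U i V"
  have gk: "g \<cdot>\<^bsub>Cat G V\<^esub> ?k = g'" and k: "?k \<in> HomSec G U i U i V"
    using g g' GV.arr_inv_comp_cancel GV.comp GV.arr_inv_Hom unfolding HomSec_def by blast+
  note Fg = HomMap_HomSec[OF U V VU i j g] and Fk = HomMap_HomSec[OF U V VU i i k]
  let ?i = "ResO H U V (MorO F U i)"
  have "?F g \<cdot>\<^bsub>Cat H V\<^esub> ?E ?k = ?F g"
    using HomMap_comp[OF U V VU i i j k g] gk eq by simp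
  also have "\<dots> = ?F g \<cdot>\<^bsub>Cat H V\<^esub> Ident (Cat H V) ?i"
    using HV.ident_right Fg by (simp add: HomSec_def)
  finally have "?E ?k = Ident (Cat H V) ?i"
    using HV.cancel_left HV.ident HV.Hom_Obj Fg Fk unfolding HomSec_def by metis
  then have k': "?k \<in> \<chi> U i V ` carrier (Sec N V)" using k by (simp add: chi_image)
  then show "n \<in> carrier (Sec N V)" unfolding n_def by (rule inv_into_into)
  show "g \<cdot>\<^bsub>Cat G V\<^esub> \<chi> U i V n = g'" using f_inv_into_f[OF k'] gk by (simp add: n_def)
qed

text \<open>The action commutes with restriction, since \<open>HomRes\<close> respects composition
  and \<open>\<chi>\<close> is a map of sheaves.\<close>

lemma HomRes_comp_chi:
  assumes W: "openin X W" "W \<subseteq> V" and g: "g \<in> HomSec G U i U j V" and n: "n \<in> carrier (Sec N V)"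
  shows "HomRes G U i U j V W (g \<cdot>\<^bsub>Cat G V\<^esub> \<chi> U i V n) =
    HomRes G U i U j V W g \<cdot>\<^bsub>Cat G W\<^esub> \<chi> U i W (Res N V W n)"
  using G.HomRes_comp[OF U V W VU i i j chi_HomSec[OF n] g] chi_res[OF U i V W VU n] by simp

end

end

section \<open>Lifting a fixed global arrow \<open>h\<close>\<close>

context
  fixes T i j h
  defines "T \<equiv> topspace X"
  assumes i: "i \<in> Obj (Cat G T)" and j: "j \<in> Obj (Cat G T)"
    and h: "h \<in> Hom (Cat H T) (MorO F T i) (MorO F T j)"
begin

lemma open_T: "openin X T"
  by (simp add: T_def)

lemma open_sub_T: "openin X V \<Longrightarrow> V \<subseteq> T"
  by (simp add: T_def openin_subset)

lemma hom_sheaf_T: "sheaf X (HomSec G T i T j) (HomRes G T i T j)"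
  using G.hom_sheaf[OF open_T i j] by (simp add: T_def)

lemma MorO_Obj_T: "MorO F T i \<in> Obj (Cat H T)" "MorO F T j \<in> Obj (Cat H T)"
  using MorO_Obj[OF open_T open_T] i j by auto

lemma hom_sheaf_MorO_T: "sheaf X (HomSec H T (MorO F T i) T (MorO F T j))
    (HomRes H T (MorO F T i) T (MorO F T j))"
  using H.hom_sheaf[OF open_T MorO_Obj_T] by (simp add: T_def)

text \<open>Guarantees that the choice in \<open>cl1\<close> yields actual local lifts. The covering
  consists of all open sets over which a lift exists, indexed by themselves to have the index type
  used in \<open>cl1\<close>.\<close>

lemma local_lifts_exist:
  "\<exists>(\<U> :: ('x set, 'x) cover) g. local_lifts X G F H i j h \<U> g"
proof -
  let ?P = "\<lambda>W g. g \<in> HomSec G T i T j W \<and> HomMap H F T i T j W g = ResM H T W h"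
  define K where "K = {W. openin X W \<and> (\<exists>g. ?P W g)}"
  have "\<exists>W\<in>K. x \<in> W" if x: "x \<in> T" for x
  proof -
    obtain W where W: "openin X W" "x \<in> W" and
      "\<exists>g\<in>HomSec G T i T j W. HomMap H F T i T j W g =
        HomRes H T (MorO F T i) T (MorO F T j) T W (ResM H T T h)"
      \<comment> \<open>Surjectivity is applied to \<open>ResM H T T h\<close>, which is a section
        over \<open>T\<close> while \<open>h\<close> is not; its restriction to \<open>W\<close> is
        again \<open>ResM H T W h\<close>.\<close>
      using hom_surj[OF open_T i j open_T subset_refl H.ResM_HomSec[OF open_T open_T subset_refl h] x]
      by blast
    then show ?thesis
      using H.HomRes_ResM[OF open_T open_T W(1) open_sub_T[OF W(1)] subset_refl MorO_Obj_T h]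
      by (auto simp: K_def)
  qed
  then have "open_covering X T (K, \<lambda>W. W)"
    using open_sub_T by (auto simp: open_covering_def K_def)
  moreover have "\<forall>W\<in>K. ?P W (SOME g. ?P W g)"
    unfolding K_def by (auto intro: someI2_ex)
  ultimately have "local_lifts X G F H i j h (K, \<lambda>W. W) (\<lambda>W. SOME g. ?P W g)"
    by (simp add: local_lifts_def T_def)
  then show ?thesis by blast
qed

context
  fixes K :: "'k set" and U g
  assumes lifts: "local_lifts X G F H i j h (K, U) g"
begin

lemma lifts_open: "\<forall>k\<in>K. openin X (U k)"
  and lift_HomSec: "k \<in> K \<Longrightarrow> g k \<in> HomSec G T i T j (U k)"
  and HomMap_lift: "k \<in> K \<Longrightarrow> HomMap H F T i T j (U k) (g k) = ResM H T (U k) h"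
  using lifts by (auto simp: local_lifts_def open_covering_def T_def)

lemma HomMap_lift_res:
  assumes k: "k \<in> K" and W: "openin X W" "W \<subseteq> U k"
  shows "HomMap H F T i T j W (HomRes G T i T j (U k) W (g k)) = ResM H T W h"
proof -
  have U: "openin X (U k)" using lifts_open k by blast
  show ?thesis
    using HomMap_HomRes[OF open_T U W open_sub_T[OF U] i j lift_HomSec[OF k]] HomMap_lift[OF k]
      H.HomRes_ResM[OF open_T U W open_sub_T[OF U] MorO_Obj_T h] by simp
qed

lemma lift_res:
  "k \<in> K \<Longrightarrow> openin X W \<Longrightarrow> W \<subseteq> U k \<Longrightarrow> HomRes G T i T j (U k) W (g k) \<in> HomSec G T i T j W"
  using G.HomRes_HomSec[OF open_T _ _ _ _ i j lift_HomSec] open_sub_T lifts_open by blast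

text \<open>Both restricted lifts have the image \<open>ResM H T W h\<close>, so transitivity of the
  action applies. The second fact is the form in which the values of the cochain enter the
  computations below.\<close>

lemma
  assumes k: "k \<in> K" and l: "l \<in> K"
  defines "W \<equiv> U k \<inter> U l" and "c \<equiv> lift_cochain X N \<chi> G i j (K, U) g"
  shows lift_cochain_mem: "c (k, l) \<in> carrier (Sec N W)"
    and comp_chi_lift_cochain: "HomRes G T i T j (U l) W (g l) \<cdot>\<^bsub>Cat G W\<^esub> \<chi> T i W (c (k, l)) =
      HomRes G T i T j (U k) W (g k)"
proof -
  have W: "openin X W" "W \<subseteq> U k" "W \<subseteq> U l" using lifts_open k l by (auto simp: W_def)
  have c: "c (k, l) = inv_into (carrier (Sec N W)) (\<chi> T i W)
      (arr_inv (Cat G W) (HomRes G T i T j (U l) W (g l)) \<cdot>\<^bsub>Cat G W\<^esub> HomRes G T i T j (U k) W (g k))"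
    using k l by (simp add: c_def lift_cochain_def Let_def W_def T_def)
  note * = open_T W(1) open_sub_T[OF W(1)] i j lift_res[OF l W(1,3)] lift_res[OF k W(1,2)]
  have eq: "HomMap H F T i T j W (HomRes G T i T j (U l) W (g l)) =
      HomMap H F T i T j W (HomRes G T i T j (U k) W (g k))"
    using HomMap_lift_res[OF k W(1,2)] HomMap_lift_res[OF l W(1,3)] by simp
  show "c (k, l) \<in> carrier (Sec N W)"
    unfolding c by (rule difference_closed[OF * eq])
  show "HomRes G T i T j (U l) W (g l) \<cdot>\<^bsub>Cat G W\<^esub> \<chi> T i W (c (k, l)) = HomRes G T i T j (U k) W (g k)"
    unfolding c by (rule comp_chi_difference[OF * eq])
qed

lemma lift_cochain_closed: "lift_cochain X N \<chi> G i j (K, U) g \<in> carrier (cech_C1 N (K, U))"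
  using lift_cochain_mem by (auto simp: cech_C1_def lift_cochain_def)

lemma lift_cochain_coboundary:
  assumes f: "f \<in> Hom (Cat G T) i j" and Ff: "MorM F T f = h"
  shows "lift_cochain X N \<chi> G i j (K, U) g \<in> cech_B1 N (K, U)"
proof -
  let ?c = "lift_cochain X N \<chi> G i j (K, U) g"
  have "\<exists>n\<in>carrier (Sec N (U k)). g k \<cdot>\<^bsub>Cat G (U k)\<^esub> \<chi> T i (U k) n = ResM G T (U k) f"
    if k: "k \<in> K" for k
  proof -
    have U: "openin X (U k)" using lifts_open k by blast
    note * = open_T U open_sub_T[OF U]
    have eq: "HomMap H F T i T j (U k) (g k) = HomMap H F T i T j (U k) (ResM G T (U k) f)"
      using HomMap_ResM[OF * i j f] HomMap_lift[OF k] Ff by simp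
    note ** = * i j lift_HomSec[OF k] G.ResM_HomSec[OF * f] eq
    show ?thesis using difference_closed[OF **] comp_chi_difference[OF **] by blast
  qed
  then obtain b where b: "\<And>k. k \<in> K \<Longrightarrow> b k \<in> carrier (Sec N (U k))"
    and gb: "\<And>k. k \<in> K \<Longrightarrow> g k \<cdot>\<^bsub>Cat G (U k)\<^esub> \<chi> T i (U k) (b k) = ResM G T (U k) f"
    by metis
  have "?c (k, l) = Res N (U l) W (b l) \<otimes>\<^bsub>Sec N W\<^esub> inv\<^bsub>Sec N W\<^esub> Res N (U k) W (b k)"
    if k: "k \<in> K" and l: "l \<in> K" and W_def: "W = U k \<inter> U l" for k l W
  proof -
    have W: "openin X W" "W \<subseteq> U k" "W \<subseteq> U l" and Uk: "openin X (U k)" and Ul: "openin X (U l)"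
      using lifts_open k l by (auto simp: W_def)
    note WT = open_sub_T[OF W(1)] and UkT = open_sub_T[OF Uk] and UlT = open_sub_T[OF Ul]
    note c = lift_cochain_mem[OF k l, folded W_def] and gc = comp_chi_lift_cochain[OF k l, folded W_def]
    interpret comm_group "Sec N W" using N.sec_group[OF W(1)] .
    have bk: "Res N (U k) W (b k) \<in> carrier (Sec N W)" and bl: "Res N (U l) W (b l) \<in> carrier (Sec N W)"
      using N.Res_closed b k l W Uk Ul by blast+
    note * = open_T W(1) WT i j lift_res[OF l W(1,3)]
    \<comment> \<open>Both \<open>c (k, l) \<otimes> b k\<close> and \<open>b l\<close>, restricted
      to \<open>W\<close>, carry the restriction of \<open>g l\<close> to that of \<open>f\<close>:
      the former by way of \<open>g k\<close>, the latter directly. Freeness of the action equates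
      them.\<close>
    have "HomRes G T i T j (U l) W (g l) \<cdot>\<^bsub>Cat G W\<^esub> \<chi> T i W (?c (k, l) \<otimes>\<^bsub>Sec N W\<^esub> Res N (U k) W (b k)) =
        ResM G T W f"
      using comp_chi_mult[OF * c bk] gc
        HomRes_comp_chi[OF open_T Uk UkT i j W(1,2) lift_HomSec[OF k] b[OF k]] gb[OF k]
        G.HomRes_ResM[OF open_T Uk W(1,2) UkT i j f] by simp
    moreover have "HomRes G T i T j (U l) W (g l) \<cdot>\<^bsub>Cat G W\<^esub> \<chi> T i W (Res N (U l) W (b l)) = ResM G T W f"
      using HomRes_comp_chi[OF open_T Ul UlT i j W(1,3) lift_HomSec[OF l] b[OF l]] gb[OF l]
        G.HomRes_ResM[OF open_T Ul W(1,3) UlT i j f] by simp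
    ultimately have "?c (k, l) \<otimes>\<^bsub>Sec N W\<^esub> Res N (U k) W (b k) = Res N (U l) W (b l)"
      using comp_chi_inj[OF * m_closed[OF c bk] bl] by simp
    then show ?thesis using inv_solve_right[OF c bl bk] by simp
  qed
  \<comment> \<open>Elements of a product group are undefined off the index set, hence the
    truncation of \<open>b\<close> to \<open>K\<close>.\<close>
  then have "?c = cech_d0 N (K, U) (restrict b K)"
    by (auto simp: cech_d0_def lift_cochain_def Let_def fun_eq_iff)
  moreover have "restrict b K \<in> carrier (cech_C0 N (K, U))"
    using b by (auto simp: cech_C0_def)
  ultimately show ?thesis by (auto simp: cech_B1_def)
qed

text \<open>\<open>L\<close> has type \<open>'x set set\<close> because \<open>glue\<close> speaks
  of coverings with that index type; the family \<open>K\<close> of the original lifts may have any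
  index type.\<close>

lemma global_lift:
  fixes L :: "'x set set"
  assumes V: "open_covering X T (L, V)" and \<tau>: "refinement (K, U) (L, V) \<tau>"
    and cob: "refine_cochain N (K, U) (L, V) \<tau> (lift_cochain X N \<chi> G i j (K, U) g) \<in> cech_B1 N (L, V)"
  shows "\<exists>f \<in> Hom (Cat G T) i j. MorM F T f = h"
proof -
  let ?c = "lift_cochain X N \<chi> G i j (K, U) g"
  obtain b where b: "\<And>l. l \<in> L \<Longrightarrow> b l \<in> carrier (Sec N (V l))"
    and cb: "refine_cochain N (K, U) (L, V) \<tau> ?c = cech_d0 N (L, V) b"
    using cob by (auto simp: cech_B1_def cech_C0_def PiE_iff)
  have k: "\<tau> l \<in> K" and VU: "V l \<subseteq> U (\<tau> l)" and open_V: "openin X (V l)" if "l \<in> L" for l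
    using \<tau> V that by (auto simp: refinement_def open_covering_def)
  have lifts_open': "openin X (U (\<tau> l))" if "l \<in> L" for l using lifts_open k that by blast
  let ?g = "\<lambda>l. HomRes G T i T j (U (\<tau> l)) (V l) (g (\<tau> l))"
  define e where "e l = ?g l \<cdot>\<^bsub>Cat G (V l)\<^esub> \<chi> T i (V l) (b l)" for l
  have g: "?g l \<in> HomSec G T i T j (V l)" if "l \<in> L" for l
    by (rule lift_res[OF k[OF that] open_V[OF that] VU[OF that]])
  have e: "e l \<in> HomSec G T i T j (V l)" if "l \<in> L" for l
    unfolding e_def
    by (rule comp_chi_HomSec[OF open_T open_V[OF that] open_sub_T[OF open_V[OF that]] i j
          g[OF that] b[OF that]])
  interpret GS: sheaf X "HomSec G T i T j" "HomRes G T i T j" by (rule hom_sheaf_T)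
  interpret HS: sheaf X "HomSec H T (MorO F T i) T (MorO F T j)" "HomRes H T (MorO F T i) T (MorO F T j)"
    by (rule hom_sheaf_MorO_T)
  have "HomRes G T i T j (V l) (V l \<inter> V m) (e l) = HomRes G T i T j (V m) (V l \<inter> V m) (e m)"
    if l: "l \<in> L" and m: "m \<in> L" for l m
  proof -
    define W W' where "W = V l \<inter> V m" and "W' = U (\<tau> l) \<inter> U (\<tau> m)"
    have W: "openin X W" "W \<subseteq> V l" "W \<subseteq> V m" and W': "openin X W'" "W' \<subseteq> U (\<tau> l)" "W' \<subseteq> U (\<tau> m)"
      and WW': "W \<subseteq> W'"
      using open_V l m VU lifts_open' by (fastforce simp: W_def W'_def)+
    note WT = open_sub_T[OF W(1)] and W'T = open_sub_T[OF W'(1)]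
    note c = lift_cochain_mem[OF k[OF l] k[OF m], folded W'_def]
      and gc = comp_chi_lift_cochain[OF k[OF l] k[OF m], folded W'_def]
    interpret comm_group "Sec N W" using N.sec_group[OF W(1)] .
    define c' bl bm where "c' = Res N W' W (?c (\<tau> l, \<tau> m))"
      and "bl = Res N (V l) W (b l)" and "bm = Res N (V m) W (b m)"
    have c': "c' \<in> carrier (Sec N W)" and bl: "bl \<in> carrier (Sec N W)" and bm: "bm \<in> carrier (Sec N W)"
      unfolding c'_def bl_def bm_def
      by (rule N.Res_closed[OF W'(1) W(1) WW' c] N.Res_closed[OF open_V[OF l] W(1,2) b[OF l]]
          N.Res_closed[OF open_V[OF m] W(1,3) b[OF m]])+
    have "refine_cochain N (K, U) (L, V) \<tau> ?c (l, m) = cech_d0 N (L, V) b (l, m)" using cb by simp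
    then have c'_eq: "c' = bm \<otimes>\<^bsub>Sec N W\<^esub> inv\<^bsub>Sec N W\<^esub> bl"
      using l m by (simp add: refine_cochain_def cech_d0_def Let_def c'_def bl_def bm_def W_def W'_def)
    have gm: "HomRes G T i T j (U (\<tau> m)) W (g (\<tau> m)) \<in> HomSec G T i T j W"
      using VU[OF m] W by (auto intro!: lift_res k m)
    have "HomRes G T i T j (V l) W (e l) = HomRes G T i T j (U (\<tau> l)) W (g (\<tau> l)) \<cdot>\<^bsub>Cat G W\<^esub> \<chi> T i W bl"
      unfolding e_def bl_def
      using HomRes_comp_chi[OF open_T open_V[OF l] open_sub_T[OF open_V[OF l]] i j W(1,2) g[OF l] b[OF l]]
        GS.res_res[OF lifts_open'[OF l] open_V[OF l] W(1,2) VU[OF l] lift_HomSec[OF k[OF l]]] by simp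
    also have "HomRes G T i T j (U (\<tau> l)) W (g (\<tau> l)) =
        HomRes G T i T j W' W (HomRes G T i T j (U (\<tau> l)) W' (g (\<tau> l)))"
      using GS.res_res[OF lifts_open'[OF l] W'(1) W(1) WW' W'(2) lift_HomSec[OF k[OF l]]] by simp
    \<comment> \<open>The relation between the lifts with indices \<open>\<tau> l\<close> and
      \<open>\<tau> m\<close> is known on \<open>W'\<close>, the overlap in the original covering,
      and is restricted to the smaller \<open>W\<close>.\<close>
    also have "\<dots> = HomRes G T i T j (U (\<tau> m)) W (g (\<tau> m)) \<cdot>\<^bsub>Cat G W\<^esub> \<chi> T i W c'"
      unfolding c'_def gc[symmetric]
      using HomRes_comp_chi[OF open_T W'(1) W'T i j W(1) WW' lift_res[OF k[OF m] W'(1,3)] c]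
        GS.res_res[OF lifts_open'[OF m] W'(1) W(1) WW' W'(3) lift_HomSec[OF k[OF m]]] by simp
    \<comment> \<open>The coboundary equation makes \<open>c' \<otimes> bl\<close> collapse to
      \<open>bm\<close>.\<close>
    also have "\<dots> \<cdot>\<^bsub>Cat G W\<^esub> \<chi> T i W bl = HomRes G T i T j (U (\<tau> m)) W (g (\<tau> m)) \<cdot>\<^bsub>Cat G W\<^esub> \<chi> T i W bm"
      using comp_chi_mult[OF open_T W(1) WT i j gm c' bl] bl bm
      by (simp add: c'_eq m_assoc)
    also have "\<dots> = HomRes G T i T j (V m) W (e m)"
      unfolding e_def bm_def
      using HomRes_comp_chi[OF open_T open_V[OF m] open_sub_T[OF open_V[OF m]] i j W(1,3) g[OF m] b[OF m]]
        GS.res_res[OF lifts_open'[OF m] open_V[OF m] W(1,3) VU[OF m] lift_HomSec[OF k[OF m]]] by simp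
    finally show ?thesis by (simp add: W_def)
  qed
  then have "\<exists>!t. t \<in> HomSec G T i T j T \<and> (\<forall>l\<in>L. HomRes G T i T j T (V l) t = e l)"
    using e by (intro GS.glue[OF open_T V] ballI) blast+
  then obtain t where t: "t \<in> HomSec G T i T j T" and te: "\<And>l. l \<in> L \<Longrightarrow> HomRes G T i T j T (V l) t = e l"
    by blast
  obtain f where f: "f \<in> Hom (Cat G T) i j" and ft: "ResM G T T f = t"
    using G.ResM_self_surj[OF open_T i j t] by blast
  note Ff = cat_functor.arr[OF functor_mor[OF open_T] f]
  let ?r = "HomRes H T (MorO F T i) T (MorO F T j)"
  have Hh: "ResM H T T k \<in> HomSec H T (MorO F T i) T (MorO F T j) T"
    and Hr: "l \<in> L \<Longrightarrow> ?r T (V l) (ResM H T T k) = ResM H T (V l) k"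
    if "k \<in> Hom (Cat H T) (MorO F T i) (MorO F T j)" for k l
    using H.ResM_HomSec[OF open_T open_T subset_refl that]
      H.HomRes_ResM[OF open_T open_T open_V open_sub_T[OF open_V] subset_refl MorO_Obj_T that] by auto
  have "ResM H T (V l) (MorM F T f) = ResM H T (V l) h" if l: "l \<in> L" for l
  proof -
    note VT = open_T open_V[OF l] open_sub_T[OF open_V[OF l]]
    have "ResM H T (V l) (MorM F T f) = HomMap H F T i T j (V l) (ResM G T (V l) f)"
      using HomMap_ResM[OF VT i j f] by simp
    also have "ResM G T (V l) f = e l"
      using G.HomRes_ResM[OF open_T open_T VT(2,3) subset_refl i j f] te[OF l] ft by simp
    also have "HomMap H F T i T j (V l) (e l) = ResM H T (V l) h"
      unfolding e_def using HomMap_comp_chi[OF VT i j g[OF l] b[OF l]]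
        HomMap_lift_res[OF k[OF l] VT(2) VU[OF l]] by simp
    finally show ?thesis .
  qed
  then have "\<forall>l\<in>L. ?r T (V l) (ResM H T T (MorM F T f)) = ResM H T (V l) h"
    "\<forall>l\<in>L. ?r T (V l) (ResM H T T h) = ResM H T (V l) h"
    using Hr[OF Ff] Hr[OF h] by auto
  moreover have "\<forall>l\<in>L. ResM H T (V l) h \<in> HomSec H T (MorO F T i) T (MorO F T j) (V l)"
    using H.ResM_HomSec[OF open_T open_V open_sub_T[OF open_V] h] by blast
  moreover have "\<forall>l\<in>L. \<forall>m\<in>L. ?r (V l) (V l \<inter> V m) (ResM H T (V l) h) =
      ?r (V m) (V l \<inter> V m) (ResM H T (V m) h)"
    using H.HomRes_ResM[OF open_T _ _ _ open_sub_T MorO_Obj_T h] open_V by (simp add: openin_Int)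
  \<comment> \<open>Both sections glue the family \<open>ResM H T (V l) h\<close>, so uniqueness in
    the sheaf axiom for \<open>H\<close> identifies them; \<open>ResM_self_inj\<close> then removes
    the restriction from \<open>T\<close> to itself.\<close>
  ultimately have "ResM H T T (MorM F T f) = ResM H T T h"
    using HS.glue[OF open_T V, of "\<lambda>l. ResM H T (V l) h"] Hh[OF Ff] Hh[OF h] by blast
  then have "MorM F T f = h" by (rule H.ResM_self_inj[OF open_T Ff h])
  with f show ?thesis by blast
qed

end

text \<open>About the covering and lifts selected by \<open>SOME\<close> only
  \<open>local_lifts\<close> is used; both implications are available for every such family.\<close>

lemma lift_iff_cl1:
  "(\<exists>f \<in> Hom (Cat G T) i j. MorM F T f = h) \<longleftrightarrow> cl1 X N \<chi> G F H i j h = \<one>\<^bsub>cech_H1 X N\<^esub>"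
proof -
  obtain K :: "'x set set" and U g where Ug: "(SOME (\<U>, g). local_lifts X G F H i j h \<U> g) = ((K, U), g)"
    by (metis surj_pair)
  have lifts: "local_lifts X G F H i j h (K, U) g"
    using someI_ex[of "\<lambda>(\<U> :: ('x set, 'x) cover, g). local_lifts X G F H i j h \<U> g"] local_lifts_exist Ug
    by auto
  let ?c = "lift_cochain X N \<chi> G i j (K, U) g"
  have cl: "cl1 X N \<chi> G F H i j h =
      cech_class X N ((K, U), cech_B1 N (K, U) #>\<^bsub>cech_Z1 N (K, U)\<^esub> ?c)"
    unfolding cl1_def Ug by (simp add: lift_class_def)
  have cov: "open_covering X (topspace X) (K, U)" using lifts by (simp add: local_lifts_def)
  show ?thesis
  proof
    assume "\<exists>f \<in> Hom (Cat G T) i j. MorM F T f = h"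
    then show "cl1 X N \<chi> G F H i j h = \<one>\<^bsub>cech_H1 X N\<^esub>"
      unfolding cl using N.cech_class_coboundary[OF cov] lift_cochain_coboundary[OF lifts] by blast
  next
    assume "cl1 X N \<chi> G F H i j h = \<one>\<^bsub>cech_H1 X N\<^esub>"
    then show "\<exists>f \<in> Hom (Cat G T) i j. MorM F T f = h"
      unfolding cl using N.cech_class_eq_one_imp[OF cov lift_cochain_closed[OF lifts]]
        global_lift[OF lifts] unfolding T_def by metis
  qed
qed

end

end

theorem theorem4p6:
  fixes X :: "'x topology"
    and N :: "('x, 'a) group_presheaf"
    and \<chi> :: "'x set \<Rightarrow> 'o \<Rightarrow> 'x set \<Rightarrow> 'a \<Rightarrow> 'm"
    and G :: "('x, 'o, 'm) prestack"
    and F :: "('x, 'o, 'm, 'p, 'n) prestack_map"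
    and H :: "('x, 'p, 'n) prestack"
    and i j :: 'o and h :: 'n
  assumes "central_extension X N \<chi> G F H"
    and "i \<in> Obj (Cat G (topspace X))" and "j \<in> Obj (Cat G (topspace X))"
    and "h \<in> Hom (Cat H (topspace X)) (MorO F (topspace X) i) (MorO F (topspace X) j)"
  shows "(\<exists>g \<in> Hom (Cat G (topspace X)) i j. MorM F (topspace X) g = h)
    \<longleftrightarrow> cl1 X N \<chi> G F H i j h = \<one>\<^bsub>cech_H1 X N\<^esub>"
  using assms by (rule central_extension.lift_iff_cl1)

end
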